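(* Let $V\subseteq B_d$ be a variety that contains at least two points, and let $(W_n)_{n\in\mathbb{N}}$ be a sequence of varieties in $B_d$. Assume that for every $n\in\mathbb{N}$ there exists a RKHS isomorphism $T_n:H_V\to H_{W_n}$ such that $T_n(k_x)=\delta_n(x)k_{F_n(x)}$ for all $x\in V$, where $F_n:V\to W_n$ is a multiplier biholomorphism and $\delta_n:V\to\mathbb{C}$ is a nowhere-vanishing function. For every $n\in\mathbb{N}$, let $\varphi_n:\mathcal{M}_V\to\mathcal{M}_{W_n}$ be the multiplier algebra isomorphism induced by $T_n$, given by $\varphi_n(f)=f\circ F_n^{-1}$ for $f\in\mathcal{M}_V$. Assume that $\|T_n\|\,\|T_n^{-1}\|\to 1$ as $n\to\infty$. Then: (1) $\|\varphi_n\|_{cb}\,\|\varphi_n^{-1}\|_{cb}\to 1$ as $n\to\infty$; (2) $\|F_n\|_{\mathrm{Mult}(V)}\to 1$ and $\|F_n^{-1}\|_{\mathrm{Mult}(W_n)}\to 1$ as $n\to\infty$.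
   Context: $d$ is a positive integer, $\mathbb{C}^d$ carries the standard inner product $\langle\cdot,\cdot\rangle$, and $B_d$ is its open unit ball. $\mathcal{H}_d^2$ is the Drury–Arveson space: the reproducing kernel Hilbert space (RKHS) on $B_d$ with kernel $k(x,y)=\frac{1}{1-\langle x,y\rangle}$; $k_x=k(\cdot,x)$. A variety in $B_d$ is a set of the form $V=\{x\in B_d: f(x)=0\ \forall f\in F\}$ for some nonempty $F\subseteq\mathcal{H}_d^2$. $H_V=\overline{\mathrm{span}}\{k_x:x\in V\}\subseteq\mathcal{H}_d^2$, identified (by restriction to $V$) with the RKHS on $V$ with kernel $k|_{V\times V}$. $\mathcal{M}_V=\mathrm{Mult}(H_V)$ is the algebra of functions $f:V\to\mathbb{C}$ with $fH_V\subseteq H_V$, identified with the algebra of multiplication operators $M_f$ on $H_V$; a matrix in $M_n(\mathcal{M}_V)$ is normed as an operator on $\oplus_{i=1}^n H_V$. For a linear map $\varphi:\mathcal{M}_V\to\mathcal{M}_W$, $\varphi^{(n)}$ is entrywise application of $\varphi$ on $n\times n$ matrices, and $\|\varphi\|_{cb}=\sup_n\|\varphi^{(n)}\|$. A vector valued multiplier on $V$ is a tuple $F=(f_1,\dots,f_d)$ with $f_i\in\mathcal{M}_V$; $\|F\|_{\mathrm{Mult}(V)}$ is the norm of the row operator $(M_{f_1},\dots,M_{f_d}):\oplus_{i=1}^d H_V\to H_V$. A multiplier biholomorphism of $V$ onto $W$ is a vector valued multiplier $F$ on $V$ mapping $V$ onto $W$ for which there is a vector valued multiplier $G$ on $W$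 with $G\circ F=\mathrm{id}_V$ and $F\circ G=\mathrm{id}_W$. A RKHS isomorphism $T:H_V\to H_W$ is a bounded invertible linear map such that $T(k_x)=\lambda(x)k_{F(x)}$ ($x\in V$) for some bijection $F:V\to W$ and some nowhere-vanishing $\lambda:V\to\mathbb{C}$. A multiplier algebra isomorphism $\varphi:\mathcal{M}_V\to\mathcal{M}_W$ is a completely bounded algebra isomorphism with completely bounded inverse of the form $\varphi(f)=f\circ G$ for a bijection $G:W\to V$. (It is known that a RKHS isomorphism $T:H_V\to H_W$ with $T(k_x)=\lambda(x)k_{F(x)}$ for all $x\in V$, where $F:V\to W$ is a bijection and $\lambda:V\to\mathbb{C}$ is nowhere-vanishing, induces the multiplier algebra isomorphism $\varphi:\mathcal{M}_V\to\mathcal{M}_W$, $\varphi(f)=f\circ F^{-1}$, with $M_{\varphi(f)}=(T^* )^{-1}M_fT^*$.) *)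

theory Defs
  imports "HOL-Analysis.Analysis"
begin

section \<open>Reproducing kernel Hilbert spaces of functions\<close>

text \<open>A function on a set \<open>X\<close> is represented by a total function that vanishes off \<open>X\<close>.\<close>

record 'a function_space =
  funs :: "('a \<Rightarrow> complex) set"
  ip :: "('a \<Rightarrow> complex) \<Rightarrow> ('a \<Rightarrow> complex) \<Rightarrow> complex"

definition hnorm :: "'a function_space \<Rightarrow> ('a \<Rightarrow> complex) \<Rightarrow> real" where
  "hnorm H f = sqrt (Re (ip H f f))"

definition kernel_fun :: "'a set \<Rightarrow> ('a \<Rightarrow> 'a \<Rightarrow> complex) \<Rightarrow> 'a \<Rightarrow> 'a \<Rightarrow> complex" where
  "kernel_fun X k y = (\<lambda>x. if x \<in> X then k x y else 0)"

locale hilbert_function_space =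
  fixes X :: "'a set" and H :: "'a function_space"
  assumes zero_outside: "\<lbrakk>f \<in> funs H; x \<notin> X\<rbrakk> \<Longrightarrow> f x = 0"
    and zero_mem: "(\<lambda>x. 0) \<in> funs H"
    and add_mem: "\<lbrakk>f \<in> funs H; g \<in> funs H\<rbrakk> \<Longrightarrow> (\<lambda>x. f x + g x) \<in> funs H"
    and scale_mem: "f \<in> funs H \<Longrightarrow> (\<lambda>x. c * f x) \<in> funs H"
    and ip_add: "\<lbrakk>f \<in> funs H; g \<in> funs H; h \<in> funs H\<rbrakk>
      \<Longrightarrow> ip H (\<lambda>x. f x + g x) h = ip H f h + ip H g h"
    and ip_scale: "\<lbrakk>f \<in> funs H; h \<in> funs H\<rbrakk> \<Longrightarrow> ip H (\<lambda>x. c * f x) h = c * ip H f h"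
    and ip_commute: "\<lbrakk>f \<in> funs H; g \<in> funs H\<rbrakk> \<Longrightarrow> ip H g f = cnj (ip H f g)"
    and ip_nonneg: "f \<in> funs H \<Longrightarrow> 0 \<le> Re (ip H f f)"
    and ip_definite: "\<lbrakk>f \<in> funs H; ip H f f = 0\<rbrakk> \<Longrightarrow> f = (\<lambda>x. 0)"
    and complete: "\<lbrakk>\<And>n::nat. s n \<in> funs H;
        \<And>e. e > 0 \<Longrightarrow> \<exists>N. \<forall>m\<ge>N. \<forall>n\<ge>N. hnorm H (\<lambda>x. s m x - s n x) < e\<rbrakk>
      \<Longrightarrow> \<exists>f\<in>funs H. (\<lambda>n. hnorm H (\<lambda>x. s n x - f x)) \<longlonglongrightarrow> 0"

locale rkhs = hilbert_function_space X H
  for X :: "'a set" and k :: "'a \<Rightarrow> 'a \<Rightarrow> complex" and H :: "'a function_space" +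
  assumes kernel_mem: "y \<in> X \<Longrightarrow> kernel_fun X k y \<in> funs H"
    and reproducing: "\<lbrakk>f \<in> funs H; y \<in> X\<rbrakk> \<Longrightarrow> f y = ip H f (kernel_fun X k y)"


section \<open>The Drury--Arveson space and its subspaces on varieties\<close>

definition cdot :: "complex ^ 'd \<Rightarrow> complex ^ 'd \<Rightarrow> complex" where
  "cdot x y = (\<Sum>i\<in>UNIV. x $ i * cnj (y $ i))"

definition da_kernel :: "complex ^ 'd \<Rightarrow> complex ^ 'd \<Rightarrow> complex" where
  "da_kernel x y = 1 / (1 - cdot x y)"

abbreviation unit_ball :: "(complex ^ 'd) set" where
  "unit_ball \<equiv> ball 0 1"

text \<open>A reproducing kernel Hilbert space is determined by its kernel, so this predicate pins down
  the Drury--Arveson space; lemma \<open>drury_arveson_exists\<close> below shows that it is satisfiable.\<close>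

definition drury_arveson :: "(complex ^ 'd) function_space \<Rightarrow> bool" where
  "drury_arveson H \<longleftrightarrow> rkhs unit_ball da_kernel H"

definition kf :: "complex ^ 'd \<Rightarrow> complex ^ 'd \<Rightarrow> complex" where
  "kf = kernel_fun unit_ball da_kernel"

definition variety :: "(complex ^ 'd) function_space \<Rightarrow> (complex ^ 'd) set \<Rightarrow> bool" where
  "variety H V \<longleftrightarrow>
    (\<exists>S. S \<noteq> {} \<and> S \<subseteq> funs H \<and> V = {x \<in> unit_ball. \<forall>f\<in>S. f x = 0})"

text \<open>The closed linear span of the kernel functions at the points of \<open>V\<close>, as a subspace of the
  whole space (its elements are functions on the ball, not restricted to \<open>V\<close>).\<close>

definition subspace_on ::
  "(complex ^ 'd) function_space \<Rightarrow> (complex ^ 'd) set \<Rightarrow> (complex ^ 'd \<Rightarrow> complex) set" where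
  "subspace_on H V = {f \<in> funs H. \<forall>e>0. \<exists>S c. finite S \<and> S \<subseteq> V \<and>
      hnorm H (\<lambda>z. f z - (\<Sum>x\<in>S. c x * kf x z)) < e}"


section \<open>Multipliers\<close>

text \<open>Elements of \<open>subspace_on H V\<close> are identified with their restrictions to \<open>V\<close>, on which
  they are uniquely determined: \<open>f\<close> is a multiplier if multiplying any such restriction by \<open>f\<close>
  gives again such a restriction, and \<open>mult_op H V f h\<close> is the element of the subspace whose
  restriction to \<open>V\<close> is \<open>f h\<close>.\<close>

definition mult_alg ::
  "(complex ^ 'd) function_space \<Rightarrow> (complex ^ 'd) set \<Rightarrow> (complex ^ 'd \<Rightarrow> complex) set" where
  "mult_alg H V = {f. (\<forall>x. x \<notin> V \<longrightarrow> f x = 0) \<and>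
      (\<forall>h\<in>subspace_on H V. \<exists>g\<in>subspace_on H V. \<forall>x\<in>V. g x = f x * h x)}"

definition mult_op ::
  "(complex ^ 'd) function_space \<Rightarrow> (complex ^ 'd) set \<Rightarrow>
    (complex ^ 'd \<Rightarrow> complex) \<Rightarrow> (complex ^ 'd \<Rightarrow> complex) \<Rightarrow> (complex ^ 'd \<Rightarrow> complex)" where
  "mult_op H V f h = (THE g. g \<in> subspace_on H V \<and> (\<forall>x\<in>V. g x = f x * h x))"

text \<open>All operator norms take values in \<^typ>\<open>ennreal\<close>, so that they are meaningful without
  knowing boundedness in advance.\<close>

definition op_norm ::
  "'a function_space \<Rightarrow> ('a \<Rightarrow> complex) set \<Rightarrow>
    (('a \<Rightarrow> complex) \<Rightarrow> ('a \<Rightarrow> complex)) \<Rightarrow> ennreal" where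
  "op_norm H S T = (SUP h\<in>{h \<in> S. hnorm H h \<le> 1}. ennreal (hnorm H (T h)))"

definition mult_matrix_norm ::
  "(complex ^ 'd) function_space \<Rightarrow> (complex ^ 'd) set \<Rightarrow> nat \<Rightarrow>
    (nat \<Rightarrow> nat \<Rightarrow> complex ^ 'd \<Rightarrow> complex) \<Rightarrow> ennreal" where
  "mult_matrix_norm H V n A =
    (SUP h\<in>{h. (\<forall>j<n. h j \<in> subspace_on H V) \<and> sqrt (\<Sum>j<n. (hnorm H (h j))\<^sup>2) \<le> 1}.
      ennreal (sqrt (\<Sum>i<n. (hnorm H (\<lambda>z. \<Sum>j<n. mult_op H V (A i j) (h j) z))\<^sup>2)))"

definition cb_norm ::
  "(complex ^ 'd) function_space \<Rightarrow> (complex ^ 'd) set \<Rightarrow> (complex ^ 'd) set \<Rightarrow>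
    ((complex ^ 'd \<Rightarrow> complex) \<Rightarrow> (complex ^ 'd \<Rightarrow> complex)) \<Rightarrow> ennreal" where
  "cb_norm H V W \<phi> = (SUP n\<in>{1..}.
      SUP A\<in>{A. (\<forall>i<n. \<forall>j<n. A i j \<in> mult_alg H V) \<and> mult_matrix_norm H V n A \<le> 1}.
        mult_matrix_norm H W n (\<lambda>i j. \<phi> (A i j)))"

text \<open>For \<open>F\<close> defined on \<open>V\<close>, values of \<open>F\<close> off \<open>V\<close> are irrelevant: its components are
  cut off outside \<open>V\<close>.\<close>

definition component ::
  "(complex ^ 'd) set \<Rightarrow> (complex ^ 'd \<Rightarrow> complex ^ 'd) \<Rightarrow> 'd \<Rightarrow> complex ^ 'd \<Rightarrow> complex" where
  "component V F i = (\<lambda>x. if x \<in> V then F x $ i else 0)"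

definition vector_multiplier ::
  "(complex ^ 'd) function_space \<Rightarrow> (complex ^ 'd) set \<Rightarrow>
    (complex ^ 'd \<Rightarrow> complex ^ 'd) \<Rightarrow> bool" where
  "vector_multiplier H V F \<longleftrightarrow> (\<forall>i. component V F i \<in> mult_alg H V)"

definition vector_mult_norm ::
  "(complex ^ 'd) function_space \<Rightarrow> (complex ^ 'd) set \<Rightarrow>
    (complex ^ 'd \<Rightarrow> complex ^ 'd) \<Rightarrow> ennreal" where
  "vector_mult_norm H V F =
    (SUP h\<in>{h. (\<forall>i. h i \<in> subspace_on H V) \<and> sqrt (\<Sum>i\<in>UNIV. (hnorm H (h i))\<^sup>2) \<le> 1}.
      ennreal (hnorm H (\<lambda>z. \<Sum>i\<in>UNIV. mult_op H V (component V F i) (h i) z)))"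

definition multiplier_biholomorphism ::
  "(complex ^ 'd) function_space \<Rightarrow> (complex ^ 'd) set \<Rightarrow> (complex ^ 'd) set \<Rightarrow>
    (complex ^ 'd \<Rightarrow> complex ^ 'd) \<Rightarrow> bool" where
  "multiplier_biholomorphism H V W F \<longleftrightarrow>
    vector_multiplier H V F \<and> F ` V = W \<and>
    (\<exists>G. vector_multiplier H W G \<and> (\<forall>x\<in>V. G (F x) = x) \<and> (\<forall>y\<in>W. F (G y) = y))"

text \<open>By the bounded inverse theorem the inverse of a bounded bijection is bounded.\<close>

definition rkhs_isomorphism ::
  "(complex ^ 'd) function_space \<Rightarrow> (complex ^ 'd) set \<Rightarrow> (complex ^ 'd) set \<Rightarrow>
    ((complex ^ 'd \<Rightarrow> complex) \<Rightarrow> (complex ^ 'd \<Rightarrow> complex)) \<Rightarrow> bool" where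
  "rkhs_isomorphism H V W T \<longleftrightarrow>
    bij_betw T (subspace_on H V) (subspace_on H W) \<and>
    (\<forall>f\<in>subspace_on H V. \<forall>g\<in>subspace_on H V. T (\<lambda>z. f z + g z) = (\<lambda>z. T f z + T g z)) \<and>
    (\<forall>c. \<forall>f\<in>subspace_on H V. T (\<lambda>z. c * f z) = (\<lambda>z. c * T f z)) \<and>
    op_norm H (subspace_on H V) T < \<infinity> \<and>
    (\<exists>F l. bij_betw F V W \<and> (\<forall>x\<in>V. l x \<noteq> 0) \<and>
      (\<forall>x\<in>V. T (kf x) = (\<lambda>z. l x * kf (F x) z)))"

definition compose_on :: "'a set \<Rightarrow> ('b \<Rightarrow> complex) \<Rightarrow> ('a \<Rightarrow> 'b) \<Rightarrow> 'a \<Rightarrow> complex" where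
  "compose_on W f G = (\<lambda>y. if y \<in> W then f (G y) else 0)"


section \<open>Existence of the Drury--Arveson space\<close>

definition l2 :: "('w \<Rightarrow> complex) \<Rightarrow> bool" where
  "l2 a \<longleftrightarrow> (\<lambda>w. (cmod (a w))\<^sup>2) summable_on UNIV"

definition l2ip :: "('w \<Rightarrow> complex) \<Rightarrow> ('w \<Rightarrow> complex) \<Rightarrow> complex" where
  "l2ip a b = (\<Sum>\<^sub>\<infinity>w. a w * cnj (b w))"

lemma l2_prod_abs:
  assumes "l2 a" "l2 b" shows "(\<lambda>w. norm (a w * cnj (b w))) summable_on UNIV"
proof (rule summable_on_comparison_test)
  show "(\<lambda>w. (cmod (a w))\<^sup>2 + (cmod (b w))\<^sup>2) summable_on UNIV"
    using assms unfolding l2_def by (rule summable_on_add)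
  fix w
  show "norm (a w * cnj (b w)) \<le> (cmod (a w))\<^sup>2 + (cmod (b w))\<^sup>2"
    using sum_squares_bound[of "cmod (a w)" "cmod (b w)"]
      mult_nonneg_nonneg[OF norm_ge_zero norm_ge_zero, of "a w" "b w"]
    unfolding norm_mult complex_mod_cnj by linarith
qed auto

lemma l2_prod: "l2 a \<Longrightarrow> l2 b \<Longrightarrow> (\<lambda>w. a w * cnj (b w)) summable_on UNIV"
  by (rule abs_summable_summable) (rule l2_prod_abs)

lemma l2_zero: "l2 (\<lambda>w. 0)" by (simp add: l2_def)

lemma l2_scale: "l2 a \<Longrightarrow> l2 (\<lambda>w. c * a w)"
  unfolding l2_def norm_mult power_mult_distrib by (rule summable_on_cmult_right)

lemma l2_add: assumes "l2 a" "l2 b" shows "l2 (\<lambda>w. a w + b w)"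
  unfolding l2_def
proof (rule summable_on_comparison_test)
  show "(\<lambda>w. 2 * (cmod (a w))\<^sup>2 + 2 * (cmod (b w))\<^sup>2) summable_on UNIV"
    using assms unfolding l2_def by (intro summable_on_add summable_on_cmult_right)
  fix w
  have "(cmod (a w + b w))\<^sup>2 \<le> (cmod (a w) + cmod (b w))\<^sup>2"
    by (intro power_mono norm_triangle_ineq) auto
  also have "\<dots> \<le> 2 * (cmod (a w))\<^sup>2 + 2 * (cmod (b w))\<^sup>2"
    using sum_squares_bound[of "cmod (a w)" "cmod (b w)"] by (simp add: power2_sum)
  finally show "(cmod (a w + b w))\<^sup>2 \<le> 2 * (cmod (a w))\<^sup>2 + 2 * (cmod (b w))\<^sup>2" .
qed auto

lemma l2_diff: "l2 a \<Longrightarrow> l2 b \<Longrightarrow> l2 (\<lambda>w. a w - b w)"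
  using l2_add[of a "\<lambda>w. - 1 * b w"] l2_scale[of b "-1"] by simp

lemma l2ip_add: "l2 a \<Longrightarrow> l2 b \<Longrightarrow> l2 c \<Longrightarrow> l2ip (\<lambda>w. a w + b w) c = l2ip a c + l2ip b c"
  unfolding l2ip_def distrib_right by (intro infsum_add l2_prod)

lemma l2ip_scale: "l2ip (\<lambda>w. c * a w) b = c * l2ip a b"
  unfolding l2ip_def mult.assoc by (rule infsum_cmult_right')

lemma l2ip_diff: "l2 a \<Longrightarrow> l2 b \<Longrightarrow> l2 c \<Longrightarrow> l2ip (\<lambda>w. a w - b w) c = l2ip a c - l2ip b c"
  using l2ip_add[of a "\<lambda>w. - 1 * b w" c] l2_scale[of b "-1"] l2ip_scale[of "-1" b c] by simp

lemma l2ip_cnj: "l2ip b a = cnj (l2ip a b)"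
  unfolding l2ip_def infsum_cnj[symmetric] by (simp add: mult.commute)

lemma l2ip_self: "l2 a \<Longrightarrow> l2ip a a = of_real (\<Sum>\<^sub>\<infinity>w. (cmod (a w))\<^sup>2)"
  unfolding l2ip_def l2_def complex_norm_square[symmetric]
  by (intro infsumI has_sum_of_real has_sum_infsum)

lemma l2ip_self_zero: assumes "l2 a" "l2ip a a = 0" shows "a = (\<lambda>w. 0)"
proof
  fix w
  have "(\<Sum>\<^sub>\<infinity>w. (cmod (a w))\<^sup>2) = 0" using assms by (simp add: l2ip_self)
  then have "(cmod (a w))\<^sup>2 = 0"
    using assms(1) unfolding l2_def
    by (intro nonneg_infsum_le_0D[where A = UNIV and f = "\<lambda>w. (cmod (a w))\<^sup>2"]) auto
  then show "a w = 0" by simp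
qed

definition l2sq :: "('w \<Rightarrow> complex) \<Rightarrow> real" where
  "l2sq a = (\<Sum>\<^sub>\<infinity>w. (cmod (a w))\<^sup>2)"

lemma l2ip_bound:
  assumes "l2 a" "l2 b" "t > 0"
  shows "2 * cmod (l2ip a b) \<le> t * l2sq a + l2sq b / t"
proof -
  have 1: "2 * cmod (l2ip a b) \<le> 2 * (\<Sum>\<^sub>\<infinity>w. norm (a w * cnj (b w)))"
    unfolding l2ip_def using norm_infsum_bound[OF l2_prod_abs[OF assms(1,2)]] by simp
  also have "\<dots> = (\<Sum>\<^sub>\<infinity>w. 2 * norm (a w * cnj (b w)))"
    by (rule infsum_cmult_right'[symmetric])
  also have "\<dots> \<le> (\<Sum>\<^sub>\<infinity>w. t * (cmod (a w))\<^sup>2 + (cmod (b w))\<^sup>2 * (1/t))"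
  proof (rule infsum_mono)
    show "(\<lambda>w. 2 * norm (a w * cnj (b w))) summable_on UNIV"
      by (intro summable_on_cmult_right l2_prod_abs assms)
    show "(\<lambda>w. t * (cmod (a w))\<^sup>2 + (cmod (b w))\<^sup>2 * (1/t)) summable_on UNIV"
      using assms unfolding l2_def
      by (intro summable_on_add summable_on_cmult_right summable_on_cmult_left)
    fix w
    have "0 \<le> (t * cmod (a w) - cmod (b w))\<^sup>2" by simp
    then have "t * (2 * cmod (a w) * cmod (b w)) \<le> t * (t * (cmod (a w))\<^sup>2 + (cmod (b w))\<^sup>2 * (1/t))"
      using assms(3) by (simp add: power2_eq_square algebra_simps)
    then show "2 * norm (a w * cnj (b w)) \<le> t * (cmod (a w))\<^sup>2 + (cmod (b w))\<^sup>2 * (1/t)"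
      using assms(3) by (simp add: norm_mult)
  qed
  also have "\<dots> = t * l2sq a + l2sq b / t"
    unfolding l2sq_def using assms unfolding l2_def
    by (subst infsum_add) (auto intro: summable_on_cmult_right summable_on_cmult_left simp: infsum_cmult_right' infsum_cmult_left' divide_inverse)
  finally show ?thesis .
qed

lemma l2_complete:
  fixes s :: "nat \<Rightarrow> 'w \<Rightarrow> complex"
  assumes s: "\<And>n. l2 (s n)"
    and C: "\<And>e. e > 0 \<Longrightarrow> \<exists>N. \<forall>m\<ge>N. \<forall>n\<ge>N. l2sq (\<lambda>w. s m w - s n w) < e"
  shows "\<exists>c. l2 c \<and> (\<lambda>n. l2sq (\<lambda>w. s n w - c w)) \<longlonglongrightarrow> 0"
proof -
  have part: "(\<Sum>w\<in>F. (cmod (s m w - s n w))\<^sup>2) \<le> l2sq (\<lambda>w. s m w - s n w)" if "finite F" for F m n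
    unfolding l2sq_def
    by (rule finite_sum_le_infsum[OF l2_diff[OF s s, unfolded l2_def] that]) simp_all
  have Cau: "Cauchy (\<lambda>n. s n w)" for w
  proof (rule metric_CauchyI)
    fix e :: real assume "e > 0"
    then obtain N where N: "\<And>m n. m \<ge> N \<Longrightarrow> n \<ge> N \<Longrightarrow> l2sq (\<lambda>w. s m w - s n w) < e\<^sup>2"
      using C[of "e\<^sup>2"] by auto
    have "dist (s m w) (s n w) < e" if "m \<ge> N" "n \<ge> N" for m n
    proof -
      have "(cmod (s m w - s n w))\<^sup>2 < e\<^sup>2"
        using part[of "{w}" m n] N[OF that] by simp
      then show ?thesis
        unfolding dist_norm by (rule power_less_imp_less_base) (use \<open>e > 0\<close> in simp)
    qed
    then show "\<exists>M. \<forall>m\<ge>M. \<forall>n\<ge>M. dist (s m w) (s n w) < e" by blast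
  qed
  define c where "c w = lim (\<lambda>n. s n w)" for w
  have c: "(\<lambda>n. s n w) \<longlonglongrightarrow> c w" for w
    using Cauchy_convergent[OF Cau[of w]] unfolding c_def convergent_LIMSEQ_iff .
  have key: "\<exists>N. \<forall>n\<ge>N. l2 (\<lambda>w. s n w - c w) \<and> l2sq (\<lambda>w. s n w - c w) \<le> e" if e: "e > 0" for e
  proof -
    obtain N where N: "\<And>m n. m \<ge> N \<Longrightarrow> n \<ge> N \<Longrightarrow> l2sq (\<lambda>w. s m w - s n w) < e"
      using C[OF e] by auto
    have "l2 (\<lambda>w. s n w - c w) \<and> l2sq (\<lambda>w. s n w - c w) \<le> e" if "n \<ge> N" for n
    proof -
      have fin: "(\<Sum>w\<in>F. (cmod (s n w - c w))\<^sup>2) \<le> e" if "finite F" for F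
      proof (rule tendsto_upperbound)
        show "(\<lambda>m. \<Sum>w\<in>F. (cmod (s n w - s m w))\<^sup>2) \<longlonglongrightarrow> (\<Sum>w\<in>F. (cmod (s n w - c w))\<^sup>2)"
          by (intro tendsto_intros c)
        show "\<forall>\<^sub>F m in sequentially. (\<Sum>w\<in>F. (cmod (s n w - s m w))\<^sup>2) \<le> e"
          using part[OF that, of n] N[OF \<open>n \<ge> N\<close>]
          unfolding eventually_sequentially by (intro exI[of _ N]) (meson less_imp_le order_trans)
      qed simp
      have "l2 (\<lambda>w. s n w - c w)" unfolding l2_def
        by (rule nonneg_bounded_partial_sums_imp_summable_on[of _ _ e]) (auto simp: fin intro!: eventually_finite_subsets_at_top_weakI)
      moreover from this have "l2sq (\<lambda>w. s n w - c w) \<le> e"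
        unfolding l2_def l2sq_def by (rule infsum_le_finite_sums) (rule fin)
      ultimately show ?thesis ..
    qed
    then show ?thesis by blast
  qed
  obtain N where "l2 (\<lambda>w. s N w - c w)" using key[of 1] by auto
  from l2_diff[OF s[of N] this] have "l2 c" by simp
  moreover have "(\<lambda>n. l2sq (\<lambda>w. s n w - c w)) \<longlonglongrightarrow> 0"
  proof (rule LIMSEQ_I)
    fix r :: real assume "r > 0"
    then obtain M where M: "\<And>n. n \<ge> M \<Longrightarrow> l2sq (\<lambda>w. s n w - c w) \<le> r/2"
      using key[of "r/2"] by auto
    have "0 \<le> l2sq a" for a :: "'w \<Rightarrow> complex" unfolding l2sq_def by (intro infsum_nonneg) auto
    then show "\<exists>no. \<forall>n\<ge>no. norm (l2sq (\<lambda>w. s n w - c w) - 0) < r"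
      using M \<open>r > 0\<close> by (intro exI[of _ M]) (fastforce simp: abs_of_nonneg)
  qed
  ultimately show ?thesis by blast
qed

text \<open>A feature map \<open>p\<close> into \<open>l2\<close> yields a reproducing kernel Hilbert space: the double
  orthogonal complement of the range of \<open>p\<close>, embedded into the functions on \<open>X\<close>.\<close>

lemma feature_map_rkhs:
  fixes p :: "'a \<Rightarrow> 'w \<Rightarrow> complex"
  assumes p: "\<And>x. x \<in> X \<Longrightarrow> l2 (p x)"
    and k: "\<And>x y. x \<in> X \<Longrightarrow> y \<in> X \<Longrightarrow> l2ip (p y) (p x) = k x y"
  shows "\<exists>H. rkhs X k H"
proof -
  define M where "M = {c. l2 c \<and> (\<forall>b. l2 b \<and> (\<forall>x\<in>X. l2ip b (p x) = 0) \<longrightarrow> l2ip c b = 0)}"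
  define E where "E = (\<lambda>c x. if x \<in> X then l2ip c (p x) else 0)"
  have Ml2: "l2 c" if "c \<in> M" for c using that by (simp add: M_def)
  have M0: "(\<lambda>w. 0) \<in> M" by (simp add: M_def l2_zero l2ip_def)
  have Madd: "(\<lambda>w. a w + b w) \<in> M" if "a \<in> M" "b \<in> M" for a b
    using that by (auto simp: M_def l2_add l2ip_add)
  have Mscale: "(\<lambda>w. c * a w) \<in> M" if "a \<in> M" for a c
    using that by (auto simp: M_def l2_scale l2ip_scale)
  have Mdiff: "(\<lambda>w. a w - b w) \<in> M" if "a \<in> M" "b \<in> M" for a b
    using that by (auto simp: M_def l2_diff l2ip_diff)
  have Mp: "p x \<in> M" if "x \<in> X" for x
    using that p by (auto simp: M_def) (metis l2ip_cnj complex_cnj_zero)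
  have E0: "E (\<lambda>w. 0) = (\<lambda>x. 0)" by (auto simp: E_def l2ip_def)
  have Eadd: "E (\<lambda>w. a w + b w) = (\<lambda>x. E a x + E b x)" if "a \<in> M" "b \<in> M" for a b
    using that by (auto simp: E_def l2ip_add Ml2 p)
  have Escale: "E (\<lambda>w. c * a w) = (\<lambda>x. c * E a x)" for a c
    by (auto simp: E_def l2ip_scale)
  have Ediff: "E (\<lambda>w. a w - b w) = (\<lambda>x. E a x - E b x)" if "a \<in> M" "b \<in> M" for a b
    using that by (auto simp: E_def l2ip_diff Ml2 p)
  have inj: "inj_on E M"
  proof (rule inj_onI)
    fix a b assume ab: "a \<in> M" "b \<in> M" "E a = E b"
    let ?c = "\<lambda>w. a w - b w"
    have c: "?c \<in> M" using Mdiff ab by blast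
    have "l2ip ?c (p x) = 0" if "x \<in> X" for x
      using fun_cong[OF ab(3), of x] that ab by (simp add: E_def l2ip_diff Ml2 p)
    then have "l2ip ?c ?c = 0" using c by (auto simp: M_def)
    then have "?c = (\<lambda>w. 0)" by (rule l2ip_self_zero[OF Ml2[OF c]])
    then show "a = b" by (auto simp: fun_eq_iff)
  qed
  define I where "I = inv_into M E"
  define H where "H = \<lparr>funs = E ` M, ip = (\<lambda>f g. l2ip (I f) (I g))\<rparr>"
  have IE: "I (E a) = a" if "a \<in> M" for a using inj that by (simp add: I_def)
  have ipE: "ip H (E a) (E b) = l2ip a b" if "a \<in> M" "b \<in> M" for a b
    using that by (simp add: H_def IE)
  have funs: "funs H = E ` M" by (simp add: H_def)
  have hn: "hnorm H (E a) = sqrt (l2sq a)" if "a \<in> M" for a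
    using that by (simp add: hnorm_def ipE l2ip_self Ml2 l2sq_def)
  have sq0: "0 \<le> l2sq a" for a :: "'w \<Rightarrow> complex" unfolding l2sq_def by (intro infsum_nonneg) auto
  have kE: "kernel_fun X k y = E (p y)" if "y \<in> X" for y
    using that by (auto simp: kernel_fun_def E_def k)
  have "rkhs X k H"
  proof
    fix f x assume "f \<in> funs H" "x \<notin> X"
    then show "f x = 0" by (auto simp: funs E_def)
  next
    show "(\<lambda>x. 0) \<in> funs H" using M0 E0 by (force simp: funs)
  next
    fix f g assume "f \<in> funs H" "g \<in> funs H"
    then show "(\<lambda>x. f x + g x) \<in> funs H" using Madd Eadd by (force simp: funs)
  next
    fix f c assume "f \<in> funs H"
    then show "(\<lambda>x. c * f x) \<in> funs H"
      using Mscale by (auto simp: funs Escale[symmetric])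
  next
    fix f g h assume "f \<in> funs H" "g \<in> funs H" "h \<in> funs H"
    then show "ip H (\<lambda>x. f x + g x) h = ip H f h + ip H g h"
      by (auto simp: funs Eadd[symmetric] ipE Madd l2ip_add Ml2)
  next
    fix f h c assume "f \<in> funs H" "h \<in> funs H"
    then show "ip H (\<lambda>x. c * f x) h = c * ip H f h"
      by (auto simp: funs Escale[symmetric] ipE Mscale l2ip_scale)
  next
    fix f g assume "f \<in> funs H" "g \<in> funs H"
    then show "ip H g f = cnj (ip H f g)" by (simp add: H_def l2ip_cnj[of "I g"])
  next
    fix f assume "f \<in> funs H"
    then show "0 \<le> Re (ip H f f)" using sq0 by (auto simp: funs ipE l2ip_self Ml2 l2sq_def)
  next
    fix f assume "f \<in> funs H" "ip H f f = 0"
    then obtain a where a: "a \<in> M" "f = E a" by (auto simp: funs)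
    then have "a = (\<lambda>w. 0)"
      using \<open>ip H f f = 0\<close> by (intro l2ip_self_zero Ml2) (simp_all add: ipE)
    then show "f = (\<lambda>x. 0)" using a E0 by simp
  next
    fix s :: "nat \<Rightarrow> 'a \<Rightarrow> complex"
    assume s: "\<And>n. s n \<in> funs H"
      and C: "\<And>e. e > 0 \<Longrightarrow> \<exists>N. \<forall>m\<ge>N. \<forall>n\<ge>N. hnorm H (\<lambda>x. s m x - s n x) < e"
    define t where "t n = I (s n)" for n
    have t: "t n \<in> M" and st: "s n = E (t n)" for n
      using s[of n] by (auto simp: t_def IE funs)
    have d: "hnorm H (\<lambda>x. s n x - E c x) = sqrt (l2sq (\<lambda>w. t n w - c w))" if "c \<in> M" for n c
      using hn[OF Mdiff[OF t[of n] that]] by (simp add: Ediff t that st)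
    have "\<exists>c. l2 c \<and> (\<lambda>n. l2sq (\<lambda>w. t n w - c w)) \<longlonglongrightarrow> 0"
    proof (rule l2_complete)
      show "l2 (t n)" for n by (rule Ml2[OF t])
      fix e :: real assume "e > 0"
      then obtain N where "\<forall>m\<ge>N. \<forall>n\<ge>N. hnorm H (\<lambda>x. s m x - s n x) < sqrt e"
        using C[of "sqrt e"] by auto
      then show "\<exists>N. \<forall>m\<ge>N. \<forall>n\<ge>N. l2sq (\<lambda>w. t m w - t n w) < e"
        using d[OF t] by (auto simp: st[symmetric])
    qed
    then obtain c where c: "l2 c" and lim: "(\<lambda>n. l2sq (\<lambda>w. t n w - c w)) \<longlonglongrightarrow> 0" by blast
    have "c \<in> M"
    proof -
      have "l2ip c b = 0" if b: "l2 b" "\<forall>x\<in>X. l2ip b (p x) = 0" for b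
      proof -
        have tb: "l2ip (t n) b = 0" for n using t[of n] b by (auto simp: M_def)
        have bd: "2 * cmod (l2ip c b) \<le> l2sq b / r" if "r > 0" for r
        proof -
          have "2 * cmod (l2ip c b) \<le> r * l2sq (\<lambda>w. t n w - c w) + l2sq b / r" for n
            using l2ip_bound[OF l2_diff[OF Ml2[OF t[of n]] c] b(1) that]
            by (simp add: l2ip_diff Ml2[OF t] c b tb)
          moreover have "(\<lambda>n. r * l2sq (\<lambda>w. t n w - c w) + l2sq b / r) \<longlonglongrightarrow> r * 0 + l2sq b / r"
            by (intro tendsto_intros lim)
          ultimately show ?thesis
            by (metis (no_types, lifting) LIMSEQ_le_const add_0 mult_zero_right)
        qed
        have "2 * cmod (l2ip c b) \<le> 0"
        proof (rule tendsto_lowerbound)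
          show "((\<lambda>r. l2sq b / r) \<longlongrightarrow> 0) at_top"
            by (intro real_tendsto_divide_at_top[OF tendsto_const] filterlim_ident)
          show "\<forall>\<^sub>F r in at_top. 2 * cmod (l2ip c b) \<le> l2sq b / r"
            using eventually_gt_at_top[of 0] by eventually_elim (rule bd)
        qed simp
        then show ?thesis by simp
      qed
      then show ?thesis using c by (auto simp: M_def)
    qed
    moreover have "(\<lambda>n. hnorm H (\<lambda>x. s n x - E c x)) \<longlonglongrightarrow> 0"
      unfolding d[OF \<open>c \<in> M\<close>] using tendsto_real_sqrt[OF lim] by simp
    ultimately show "\<exists>f\<in>funs H. (\<lambda>n. hnorm H (\<lambda>x. s n x - f x)) \<longlonglongrightarrow> 0"
      by (auto simp: funs)
  next
    fix y assume "y \<in> X"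
    then show "kernel_fun X k y \<in> funs H" by (simp add: kE funs Mp)
  next
    fix f y assume "f \<in> funs H" "y \<in> X"
    then show "f y = ip H f (kernel_fun X k y)"
      by (auto simp: kE funs ipE Mp) (simp add: E_def)
  qed
  then show ?thesis by blast
qed

text \<open>Words \<open>w\<close> over the coordinate indices stand for monomials, and expanding the geometric
  series of \<open>cdot x y\<close> shows that the monomials form a feature map for the kernel.\<close>

lemma finite_words: "finite {w :: 'd::finite list. length w < N}"
proof (rule finite_subset)
  show "{w :: 'd list. length w < N} \<subseteq> {w. set w \<subseteq> UNIV \<and> length w \<le> N}" by auto
  show "finite {w. set w \<subseteq> (UNIV :: 'd set) \<and> length w \<le> N}" by (rule finite_lists_length_le) simp
qed

lemma sum_words_eq:
  fixes g :: "'d::finite \<Rightarrow> 'b::comm_ring_1"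
  shows "(\<Sum>w | length w = n. prod_list (map g w)) = (\<Sum>i\<in>UNIV. g i) ^ n"
proof (induction n)
  case 0 show ?case by simp
next
  case (Suc n)
  have "{w. length w = Suc n} = (\<lambda>(i, v). i # v) ` (UNIV \<times> {v :: 'd list. length v = n})"
    by (auto simp: length_Suc_conv)
  moreover have "inj_on (\<lambda>(i, v). i # v) (UNIV \<times> {v :: 'd list. length v = n})"
    by (auto simp: inj_on_def)
  ultimately have "(\<Sum>w | length w = Suc n. prod_list (map g w))
      = (\<Sum>(i, v)\<in>UNIV \<times> {v. length v = n}. g i * prod_list (map g v))"
    by (simp add: sum.reindex case_prod_unfold)
  also have "\<dots> = (\<Sum>i\<in>UNIV. g i) * (\<Sum>v | length v = n. prod_list (map g v))"
    by (simp add: sum_product sum.cartesian_product)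
  finally show ?case by (simp add: Suc.IH)
qed

lemma sum_words_less:
  fixes g :: "'d::finite \<Rightarrow> 'b::comm_ring_1"
  shows "(\<Sum>w | length w < N. prod_list (map g w)) = (\<Sum>n<N. (\<Sum>i\<in>UNIV. g i) ^ n)"
proof -
  have "(\<Sum>w | length w < N. prod_list (map g w))
      = (\<Sum>n<N. \<Sum>w | w \<in> {w. length w < N} \<and> length w = n. prod_list (map g w))"
    by (rule sum.group[symmetric]) (auto intro: finite_words)
  also have "\<dots> = (\<Sum>n<N. \<Sum>w | length w = n. prod_list (map g w))"
    by (intro sum.cong) auto
  finally show ?thesis by (simp add: sum_words_eq)
qed

lemma words_in_less: "finite F \<Longrightarrow> \<exists>N. F \<subseteq> {w. length w < N}"
  by (rule exI[of _ "Suc (Max (length ` F))"]) (auto simp: less_Suc_eq_le)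

lemma words_summable:
  fixes g :: "'d::finite \<Rightarrow> real"
  assumes g: "\<And>i. 0 \<le> g i" and "(\<Sum>i\<in>UNIV. g i) < 1"
  shows "(\<lambda>w. prod_list (map g w)) summable_on UNIV"
proof -
  have nn: "0 \<le> prod_list (map g w)" for w by (induction w) (auto simp: g)
  let ?q = "\<Sum>i\<in>UNIV. g i"
  have q: "0 \<le> ?q" by (intro sum_nonneg g)
  have "sum (\<lambda>w. prod_list (map g w)) F \<le> 1 / (1 - ?q)" if "finite F" for F
  proof -
    obtain N where "F \<subseteq> {w. length w < N}" using words_in_less[OF \<open>finite F\<close>] by blast
    then have "sum (\<lambda>w. prod_list (map g w)) F \<le> (\<Sum>w | length w < N. prod_list (map g w))"
      by (intro sum_mono2 finite_words nn)
    also have "\<dots> = (\<Sum>n<N. ?q ^ n)" by (rule sum_words_less)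
    also have "\<dots> \<le> (\<Sum>n. ?q ^ n)"
      using q assms(2) by (intro sum_le_suminf summable_geometric) auto
    also have "\<dots> = 1 / (1 - ?q)" using q assms(2) by (intro suminf_geometric) auto
    finally show ?thesis .
  qed
  then show ?thesis
    by (intro nonneg_bounded_partial_sums_imp_summable_on[of _ _ "1 / (1 - ?q)"] eventually_finite_subsets_at_top_weakI) (auto simp: nn)
qed

lemma words_infsum:
  fixes g :: "'d::finite \<Rightarrow> complex"
  assumes s: "(\<lambda>w. prod_list (map g w)) summable_on UNIV" and q: "cmod (\<Sum>i\<in>UNIV. g i) < 1"
  shows "(\<Sum>\<^sub>\<infinity>w. prod_list (map g w)) = 1 / (1 - (\<Sum>i\<in>UNIV. g i))"
proof (rule LIMSEQ_unique)
  let ?A = "\<lambda>N. {w :: 'd list. length w < N}"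
  have fl: "filterlim ?A (finite_subsets_at_top UNIV) sequentially"
    unfolding filterlim_iff
  proof (intro allI impI)
    fix P assume "eventually P (finite_subsets_at_top (UNIV :: 'd list set))"
    then obtain F :: "'d list set" where F: "finite F"
        "\<And>Y. finite Y \<Longrightarrow> F \<subseteq> Y \<Longrightarrow> P Y"
      by (auto simp: eventually_finite_subsets_at_top)
    obtain N where N: "F \<subseteq> ?A N" using words_in_less[OF F(1)] by blast
    have "\<forall>n\<ge>N. P (?A n)"
    proof (intro allI impI)
      fix n assume "N \<le> n"
      then have "F \<subseteq> ?A n" using N by fastforce
      then show "P (?A n)" by (intro F(2) finite_words)
    qed
    then show "\<forall>\<^sub>F n in sequentially. P (?A n)" by (auto simp: eventually_sequentially)
  qed
  have "(sum (\<lambda>w. prod_list (map g w)) \<longlongrightarrow> (\<Sum>\<^sub>\<infinity>w. prod_list (map g w))) (finite_subsets_at_top UNIV)"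
    using has_sum_infsum[OF s] by (simp add: has_sum_def)
  from filterlim_compose[OF this fl]
  show "(\<lambda>N. \<Sum>n<N. (\<Sum>i\<in>UNIV. g i) ^ n) \<longlonglongrightarrow> (\<Sum>\<^sub>\<infinity>w. prod_list (map g w))"
    by (simp add: sum_words_less)
  show "(\<lambda>N. \<Sum>n<N. (\<Sum>i\<in>UNIV. g i) ^ n) \<longlonglongrightarrow> 1 / (1 - (\<Sum>i\<in>UNIV. g i))"
    using geometric_sums[OF q] by (simp add: sums_def)
qed

lemma drury_arveson_exists: "\<exists>H :: (complex ^ 'd) function_space. drury_arveson H"
  unfolding drury_arveson_def
proof (rule feature_map_rkhs)
  let ?p = "\<lambda>(y :: complex ^ 'd) w. prod_list (map (\<lambda>i. cnj (y $ i)) w)"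
  fix x :: "complex ^ 'd" assume x: "x \<in> unit_ball"
  have nx: "(\<Sum>i\<in>UNIV. (cmod (x $ i))\<^sup>2) < 1"
    using x by (simp add: norm_vec_def L2_set_def)
  have sq: "(cmod (?p x w))\<^sup>2 = prod_list (map (\<lambda>i. (cmod (x $ i))\<^sup>2) w)" for w
    by (induction w) (auto simp: norm_mult power_mult_distrib)
  show l2x: "l2 (?p x)"
    unfolding l2_def sq by (intro words_summable nx) auto
  fix y :: "complex ^ 'd" assume y: "y \<in> unit_ball"
  have ny: "(\<Sum>i\<in>UNIV. (cmod (y $ i))\<^sup>2) < 1"
    using y by (simp add: norm_vec_def L2_set_def)
  have sqy: "(cmod (?p y w))\<^sup>2 = prod_list (map (\<lambda>i. (cmod (y $ i))\<^sup>2) w)" for w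
    by (induction w) (auto simp: norm_mult power_mult_distrib)
  have l2y: "l2 (?p y)"
    unfolding l2_def sqy by (intro words_summable ny) auto
  have eq: "?p y w * cnj (?p x w) = prod_list (map (\<lambda>i. x $ i * cnj (y $ i)) w)" for w
    by (induction w) (auto simp: algebra_simps)
  have "cmod (\<Sum>i\<in>UNIV. x $ i * cnj (y $ i)) \<le> (\<Sum>i\<in>UNIV. \<bar>cmod (x $ i)\<bar> * \<bar>cmod (y $ i)\<bar>)"
    by (rule sum_norm_le) (simp add: norm_mult)
  also have "\<dots> \<le> norm x * norm y"
    unfolding norm_vec_def by (rule L2_set_mult_ineq)
  also have "\<dots> < 1"
    using x y by (simp, metis mult_strict_mono norm_ge_zero mult_1 zero_less_one)
  finally have q: "cmod (\<Sum>i\<in>UNIV. x $ i * cnj (y $ i)) < 1" .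
  show "l2ip (?p y) (?p x) = da_kernel x y"
    unfolding l2ip_def eq da_kernel_def cdot_def
    using l2_prod[OF l2y l2x] by (intro words_infsum q) (simp add: eq)
qed

end

theory Submission
  imports Defs
begin

text \<open>
  Let \<open>L = \<parallel>T\<parallel> \<parallel>T\<inverse>\<parallel>\<close>. The adjoint \<open>T\<^sup>*\<close> acts on values by \<open>(T\<^sup>* h) x = cnj (\<delta> x) * h (F x)\<close>, hence
  intertwines multiplication by \<open>f\<close> and by \<open>f \<circ> F\<inverse>\<close>; so both completely bounded norms are at
  most \<open>L\<close>, and they are at least \<open>1\<close> because units go to units. The coordinate row is a contraction
  on every subspace, and transporting it along \<open>T\<close> bounds the row norms of \<open>F\<close> and \<open>F\<inverse>\<close> by \<open>L\<close>.

  For the lower bound, \<open>T\<close> changes the squared sine of the angle between two kernel functions by a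
  factor at most \<open>L\<^sup>2\<close>. If the row norm of \<open>F\<close> is \<open>r < 1\<close>, positivity on a pair of points forces
  \<open>F\<close> to shrink this sine by a definite amount depending on \<open>r\<close>, so \<open>r\<close> tends to \<open>1\<close> as \<open>L\<close> does.
\<close>

section \<open>Hilbert function spaces\<close>

text \<open>Two distinct points are essential for the lower bounds on the row norms. Over a single
  point the space is one-dimensional, every isomorphism is a multiple of an isometry, and the row
  norm of \<open>F\<close> is the length of the image point, which can be any number below 1. So the
  test quantity must involve a pair of points and must not see the scalars \<open>\<delta>\<close>;
  the overlap of two kernel functions depends only on the lines that they span. For the inverse maps
  there is a further obstacle: the test pair \<open>F n x\<close>, \<open>F n y\<close> moves with
  \<open>n\<close>, and its overlap must be kept away from 1 uniformly. The same distortion estimate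
  for \<open>T n\<close> achieves this.\<close>

context hilbert_function_space
begin

lemma sum_mem:
  assumes "\<And>i. i \<in> A \<Longrightarrow> f i \<in> funs H"
  shows "(\<lambda>z. \<Sum>i\<in>A. c i * f i z) \<in> funs H"
  using assms
proof (induction A rule: infinite_finite_induct)
  case (insert i A)
  then show ?case using add_mem[OF scale_mem[of "f i" "c i"], of "\<lambda>z. \<Sum>i\<in>A. c i * f i z"] by simp
qed (simp_all add: zero_mem)

lemma diff_mem: "f \<in> funs H \<Longrightarrow> g \<in> funs H \<Longrightarrow> (\<lambda>z. f z - g z) \<in> funs H"
  using add_mem[of f "\<lambda>z. - 1 * g z"] scale_mem[of g "- 1"] by simp

lemma ip_diff:
  assumes "f \<in> funs H" "g \<in> funs H" "h \<in> funs H"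
  shows "ip H (\<lambda>z. f z - g z) h = ip H f h - ip H g h"
  using ip_add[of f "\<lambda>z. - 1 * g z" h] ip_scale[of g h "- 1"] scale_mem[of g "- 1"] assms by simp

lemma ip_zero: "h \<in> funs H \<Longrightarrow> ip H (\<lambda>z. 0) h = 0"
  using ip_scale[of "\<lambda>z. 0" h 0] zero_mem by simp

lemma ip_sum:
  assumes "\<And>i. i \<in> A \<Longrightarrow> f i \<in> funs H" "h \<in> funs H"
  shows "ip H (\<lambda>z. \<Sum>i\<in>A. c i * f i z) h = (\<Sum>i\<in>A. c i * ip H (f i) h)"
  using assms
  by (induction A rule: infinite_finite_induct) (simp_all add: ip_zero ip_add ip_scale scale_mem sum_mem)

lemma ip_add_right:
  assumes "f \<in> funs H" "g \<in> funs H" "h \<in> funs H"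
  shows "ip H f (\<lambda>z. g z + h z) = ip H f g + ip H f h"
  using ip_commute[of "\<lambda>z. g z + h z" f] assms
  by (simp add: ip_add add_mem ip_commute[of g f] ip_commute[of h f])

lemma ip_scale_right:
  assumes "f \<in> funs H" "g \<in> funs H"
  shows "ip H f (\<lambda>z. c * g z) = cnj c * ip H f g"
  using ip_commute[of "\<lambda>z. c * g z" f] assms by (simp add: ip_scale scale_mem ip_commute[of g f])

lemma ip_diff_right:
  assumes "f \<in> funs H" "g \<in> funs H" "h \<in> funs H"
  shows "ip H f (\<lambda>z. g z - h z) = ip H f g - ip H f h"
  using ip_commute[of "\<lambda>z. g z - h z" f] assms
  by (simp add: ip_diff diff_mem ip_commute[of g f] ip_commute[of h f])

lemma ip_sum_right:
  assumes "\<And>i. i \<in> A \<Longrightarrow> f i \<in> funs H" "h \<in> funs H"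
  shows "ip H h (\<lambda>z. \<Sum>i\<in>A. c i * f i z) = (\<Sum>i\<in>A. cnj (c i) * ip H h (f i))"
proof -
  have "ip H h (\<lambda>z. \<Sum>i\<in>A. c i * f i z) = cnj (\<Sum>i\<in>A. c i * ip H (f i) h)"
    using assms by (subst ip_sum[symmetric]) (auto intro: ip_commute sum_mem)
  also have "\<dots> = (\<Sum>i\<in>A. cnj (c i) * ip H h (f i))"
    using assms by (auto intro!: sum.cong simp: ip_commute[symmetric])
  finally show ?thesis .
qed

lemma ip_self: assumes "f \<in> funs H" shows "ip H f f = of_real ((hnorm H f)\<^sup>2)"
proof (rule complex_eqI)
  show "Re (ip H f f) = Re (of_real ((hnorm H f)\<^sup>2))"
    using ip_nonneg[OF assms] by (simp add: hnorm_def)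
  show "Im (ip H f f) = Im (of_real ((hnorm H f)\<^sup>2))"
    using arg_cong[OF ip_commute[OF assms assms], of Im] by simp
qed

lemma hnorm_nonneg: "f \<in> funs H \<Longrightarrow> 0 \<le> hnorm H f"
  by (simp add: hnorm_def ip_nonneg)

lemma hnorm_zero: "hnorm H (\<lambda>z. 0) = 0"
  by (simp add: hnorm_def ip_zero zero_mem)

lemma hnorm_eq_zero: "f \<in> funs H \<Longrightarrow> hnorm H f = 0 \<Longrightarrow> f = (\<lambda>z. 0)"
  by (rule ip_definite) (auto simp: ip_self)

lemma hnorm_scale: assumes "f \<in> funs H" shows "hnorm H (\<lambda>z. c * f z) = cmod c * hnorm H f"
proof -
  have "ip H (\<lambda>z. c * f z) (\<lambda>z. c * f z) = of_real ((cmod c * hnorm H f)\<^sup>2)"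
    using assms complex_norm_square[of c]
    by (simp add: ip_scale ip_scale_right scale_mem ip_self power_mult_distrib algebra_simps)
  then show ?thesis
    using hnorm_nonneg[OF assms] by (simp add: hnorm_def)
qed

lemma hnorm_add_square:
  assumes "f \<in> funs H" "g \<in> funs H"
  shows "(hnorm H (\<lambda>z. f z + g z))\<^sup>2 = (hnorm H f)\<^sup>2 + 2 * Re (ip H f g) + (hnorm H g)\<^sup>2"
proof -
  have "complex_of_real ((hnorm H (\<lambda>z. f z + g z))\<^sup>2) = ip H f f + ip H f g + cnj (ip H f g) + ip H g g"
    using assms
    by (simp add: ip_self[symmetric] add_mem ip_add ip_add_right ip_commute[of f g] del: of_real_power)
  from arg_cong[OF this, of Re] show ?thesis
    using assms by (simp add: ip_self)
qed

lemma hnorm_diff_square: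
  assumes "f \<in> funs H" "g \<in> funs H"
  shows "(hnorm H (\<lambda>z. f z - g z))\<^sup>2 = (hnorm H f)\<^sup>2 - 2 * Re (ip H f g) + (hnorm H g)\<^sup>2"
  using hnorm_add_square[of f "\<lambda>z. - 1 * g z"] hnorm_scale[of g "- 1"]
    ip_scale_right[of f g "- 1"] scale_mem[of g "- 1"] assms by simp

text \<open>Both sides are the Gram determinant of \<open>f\<close> and \<open>g\<close>: the
  squared distance from \<open>f\<close> to the line through \<open>g\<close>, times the squared
  norm of \<open>g\<close>. That factor keeps the identity true when \<open>g\<close> has norm 0.
  Cauchy-Schwarz is its nonnegativity.\<close>

lemma hnorm_diff_proj:
  assumes f: "f \<in> funs H" and g: "g \<in> funs H"
  shows "(hnorm H g)\<^sup>2 * (hnorm H (\<lambda>z. f z - ip H f g / of_real ((hnorm H g)\<^sup>2) * g z))\<^sup>2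
    = (hnorm H f)\<^sup>2 * (hnorm H g)\<^sup>2 - (cmod (ip H f g))\<^sup>2"
proof (cases "hnorm H g = 0")
  case True
  then have "ip H f g = 0"
    using f g hnorm_eq_zero[of g] ip_commute[of "\<lambda>z. 0" f] zero_mem by (simp add: ip_zero)
  then show ?thesis using True by simp
next
  case False
  let ?n = "(hnorm H g)\<^sup>2"
  let ?c = "ip H f g / of_real ?n"
  have r: "Re (cnj ?c * ip H f g) = (cmod (ip H f g))\<^sup>2 / ?n"
  proof -
    have "cnj ?c * ip H f g = of_real ((cmod (ip H f g))\<^sup>2 / ?n)"
      using complex_norm_square[of "ip H f g"] by (simp add: mult.commute)
    then show ?thesis by (simp only: Re_complex_of_real)
  qed
  have "(hnorm H (\<lambda>z. f z - ?c * g z))\<^sup>2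
      = (hnorm H f)\<^sup>2 - 2 * ((cmod (ip H f g))\<^sup>2 / ?n) + (cmod ?c * hnorm H g)\<^sup>2"
    using f g r by (simp only: hnorm_diff_square scale_mem ip_scale_right hnorm_scale)
  also have "cmod ?c = cmod (ip H f g) / ?n"
    by (simp only: norm_divide norm_of_real abs_power2)
  also have "(\<dots> * hnorm H g)\<^sup>2 = (cmod (ip H f g))\<^sup>2 / ?n"
    using False by (simp add: power_mult_distrib power_divide power2_eq_square)
  finally show ?thesis using False by (simp add: field_simps)
qed

lemma Cauchy_Schwarz:
  assumes f: "f \<in> funs H" and g: "g \<in> funs H"
  shows "cmod (ip H f g) \<le> hnorm H f * hnorm H g"
proof (rule power2_le_imp_le)
  have "0 \<le> (hnorm H f)\<^sup>2 * (hnorm H g)\<^sup>2 - (cmod (ip H f g))\<^sup>2"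
    by (subst hnorm_diff_proj[OF assms, symmetric]) simp
  then show "(cmod (ip H f g))\<^sup>2 \<le> (hnorm H f * hnorm H g)\<^sup>2"
    by (simp add: power_mult_distrib)
qed (simp add: assms hnorm_nonneg)

text \<open>The orthogonal projection is the best choice of coefficient, so any other
  \<open>c\<close> only increases the right-hand side. This serves when \<open>c\<close> is fixed
  before an operator is applied and orthogonality is lost.\<close>

lemma gram_det_le:
  assumes f: "f \<in> funs H" and g: "g \<in> funs H"
  shows "(hnorm H f)\<^sup>2 * (hnorm H g)\<^sup>2 - (cmod (ip H f g))\<^sup>2
    \<le> (hnorm H (\<lambda>z. f z - c * g z))\<^sup>2 * (hnorm H g)\<^sup>2"
proof (cases "hnorm H g = 0")
  case False
  let ?d = "ip H f g / of_real ((hnorm H g)\<^sup>2)"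
  let ?u = "\<lambda>z. f z - ?d * g z"
  have u: "?u \<in> funs H" by (intro diff_mem scale_mem f g)
  have "ip H ?u g = ip H f g - ?d * of_real ((hnorm H g)\<^sup>2)"
    using f g by (simp only: ip_diff ip_scale scale_mem ip_self)
  then have "ip H ?u g = 0" using False by simp
  \<comment> \<open>Pythagoras: \<open>f - c * g\<close> is \<open>?u\<close> plus a multiple of
    \<open>g\<close>, and \<open>?u\<close> is orthogonal to \<open>g\<close>.\<close>
  then have "(hnorm H (\<lambda>z. ?u z + (?d - c) * g z))\<^sup>2
      = (hnorm H ?u)\<^sup>2 + (hnorm H (\<lambda>z. (?d - c) * g z))\<^sup>2"
    using u g by (simp add: hnorm_add_square scale_mem ip_scale_right)
  then have "(hnorm H ?u)\<^sup>2 \<le> (hnorm H (\<lambda>z. f z - c * g z))\<^sup>2"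
    by (simp add: algebra_simps)
  then have "(hnorm H g)\<^sup>2 * (hnorm H ?u)\<^sup>2 \<le> (hnorm H g)\<^sup>2 * (hnorm H (\<lambda>z. f z - c * g z))\<^sup>2"
    by (intro mult_left_mono) auto
  then show ?thesis unfolding hnorm_diff_proj[OF f g] by (simp add: mult.commute)
qed (use hnorm_diff_proj[OF f g] in simp)

lemma hnorm_triangle:
  assumes f: "f \<in> funs H" and g: "g \<in> funs H"
  shows "hnorm H (\<lambda>z. f z + g z) \<le> hnorm H f + hnorm H g"
proof (rule power2_le_imp_le)
  have "Re (ip H f g) \<le> hnorm H f * hnorm H g"
    using complex_Re_le_cmod[of "ip H f g"] Cauchy_Schwarz[OF f g] by linarith
  then show "(hnorm H (\<lambda>z. f z + g z))\<^sup>2 \<le> (hnorm H f + hnorm H g)\<^sup>2"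
    using f g by (simp add: hnorm_add_square power2_sum)
qed (simp add: f g hnorm_nonneg)

lemma hnorm_diff_commute:
  assumes "f \<in> funs H" "g \<in> funs H"
  shows "hnorm H (\<lambda>z. f z - g z) = hnorm H (\<lambda>z. g z - f z)"
  using hnorm_scale[of "\<lambda>z. g z - f z" "- 1"] assms by (simp add: diff_mem)

lemma hnorm_tendsto:
  assumes s: "\<And>n. s n \<in> funs H" and f: "f \<in> funs H"
    and lim: "(\<lambda>n. hnorm H (\<lambda>z. s n z - f z)) \<longlonglongrightarrow> 0"
  shows "(\<lambda>n. hnorm H (s n)) \<longlonglongrightarrow> hnorm H f"
proof (rule LIM_zero_cancel, rule Lim_null_comparison[OF _ lim], intro always_eventually allI)
  fix n
  have "hnorm H f \<le> hnorm H (\<lambda>z. f z - s n z) + hnorm H (s n)"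
    using hnorm_triangle[of "\<lambda>z. f z - s n z" "s n"] s f by (simp add: diff_mem)
  moreover have "hnorm H (s n) \<le> hnorm H (\<lambda>z. s n z - f z) + hnorm H f"
    using hnorm_triangle[of "\<lambda>z. s n z - f z" f] s f by (simp add: diff_mem)
  ultimately show "norm (hnorm H (s n) - hnorm H f) \<le> hnorm H (\<lambda>z. s n z - f z)"
    using hnorm_diff_commute[OF f s[of n]] by simp
qed

text \<open>If \<open>u\<close> represents \<open>L\<close>, completing the square shows that
  \<open>Q f\<close> is the squared norm of \<open>f - u\<close> minus that of \<open>u\<close>.
  This is why minimising \<open>Q\<close> finds \<open>u\<close>; completeness provides the
  minimiser.\<close>

lemma Riesz_representation:
  fixes L :: "('a \<Rightarrow> complex) \<Rightarrow> complex"
  assumes add: "\<And>f g. f \<in> funs H \<Longrightarrow> g \<in> funs H \<Longrightarrow> L (\<lambda>z. f z + g z) = L f + L g"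
    and scale: "\<And>c f. f \<in> funs H \<Longrightarrow> L (\<lambda>z. c * f z) = c * L f"
    and bound: "\<And>f. f \<in> funs H \<Longrightarrow> cmod (L f) \<le> C * hnorm H f"
  obtains u where "u \<in> funs H" "\<And>f. f \<in> funs H \<Longrightarrow> L f = ip H f u"
proof -
  \<comment> \<open>The representing element is the minimiser of \<open>Q\<close>.\<close>
  define Q where "Q f = (hnorm H f)\<^sup>2 - 2 * Re (L f)" for f
  have diff: "L (\<lambda>z. f z - g z) = L f - L g" if "f \<in> funs H" "g \<in> funs H" for f g
    using add[of f "\<lambda>z. - 1 * g z"] scale[of g "- 1"] scale_mem[of g "- 1"] that by simp
  have lower: "- C\<^sup>2 \<le> Q f" if "f \<in> funs H" for f
  proof -
    have "0 \<le> (hnorm H f - C)\<^sup>2" by simp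
    then show ?thesis
      using bound[OF that] complex_Re_le_cmod[of "L f"] by (simp add: Q_def power2_diff mult.commute)
  qed
  define m where "m = Inf (Q ` funs H)"
  have bdd: "bdd_below (Q ` funs H)" using lower by (auto simp: bdd_below_def)
  have m_le: "m \<le> Q f" if "f \<in> funs H" for f
    unfolding m_def using bdd that by (auto intro: cInf_lower)
  have "\<exists>f\<in>funs H. Q f < m + inverse (Suc n)" for n
    using cInf_lessD[of "Q ` funs H" "m + inverse (Suc n)"] zero_mem by (auto simp: m_def[symmetric])
  then obtain s where s: "s n \<in> funs H" and sm: "Q (s n) < m + inverse (Suc n)" for n
    by metis
  \<comment> \<open>Parallelogram law: \<open>Q\<close> at the midpoint \<open>?h\<close> is at
    least \<open>m\<close>, so two near-minimisers are close to each other.\<close>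
  have close: "(hnorm H (\<lambda>z. s i z - s j z))\<^sup>2 < 2 * inverse (Suc i) + 2 * inverse (Suc j)" for i j
  proof -
    let ?h = "\<lambda>z. (1/2) * (s i z + s j z)"
    have "?h \<in> funs H" by (intro scale_mem add_mem s)
    from m_le[OF this] have "4 * m \<le> 4 * Q ?h" by linarith
    also have "4 * Q ?h = (hnorm H (\<lambda>z. s i z + s j z))\<^sup>2 - 4 * Re (L (s i) + L (s j))"
    proof -
      have "hnorm H ?h = hnorm H (\<lambda>z. s i z + s j z) / 2" "L ?h = (L (s i) + L (s j)) / 2"
        by (subst hnorm_scale scale; simp add: s add add_mem)+
      then show ?thesis unfolding Q_def by (simp only:) (simp add: power_divide add_divide_distrib)
    qed
    finally have "(hnorm H (\<lambda>z. s i z - s j z))\<^sup>2 \<le> 2 * Q (s i) + 2 * Q (s j) - 4 * m"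
      using s by (simp add: Q_def hnorm_add_square hnorm_diff_square)
    then show ?thesis using sm[of i] sm[of j] by linarith
  qed
  have "\<exists>u\<in>funs H. (\<lambda>n. hnorm H (\<lambda>z. s n z - u z)) \<longlonglongrightarrow> 0"
  proof (rule complete[OF s])
    fix e :: real assume "e > 0"
    then obtain N where N: "inverse (real (Suc N)) < e\<^sup>2 / 4"
      using reals_Archimedean[of "e\<^sup>2 / 4"] by auto
    have "hnorm H (\<lambda>z. s i z - s j z) < e" if "i \<ge> N" "j \<ge> N" for i j
    proof (rule power2_less_imp_less)
      have "inverse (real (Suc i)) \<le> inverse (real (Suc N))" "inverse (real (Suc j)) \<le> inverse (real (Suc N))"
        using that by (auto intro!: le_imp_inverse_le)
      then show "(hnorm H (\<lambda>z. s i z - s j z))\<^sup>2 < e\<^sup>2"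
        using close[of i j] N by linarith
    qed (use \<open>e > 0\<close> in simp)
    then show "\<exists>N. \<forall>i\<ge>N. \<forall>j\<ge>N. hnorm H (\<lambda>z. s i z - s j z) < e" by blast
  qed
  then obtain u where u: "u \<in> funs H" and lim: "(\<lambda>n. hnorm H (\<lambda>z. s n z - u z)) \<longlonglongrightarrow> 0"
    by blast
  have "(\<lambda>n. L (s n)) \<longlonglongrightarrow> L u"
  proof (rule LIM_zero_cancel, rule Lim_null_comparison)
    show "(\<lambda>n. C * hnorm H (\<lambda>z. s n z - u z)) \<longlonglongrightarrow> 0"
      using tendsto_mult_left[OF lim, of C] by simp
    show "\<forall>\<^sub>F n in sequentially. norm (L (s n) - L u) \<le> C * hnorm H (\<lambda>z. s n z - u z)"
      using bound[OF diff_mem[OF s u]] diff[OF s u] by simp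
  qed
  then have "(\<lambda>n. Q (s n)) \<longlonglongrightarrow> Q u"
    unfolding Q_def by (intro tendsto_intros hnorm_tendsto[OF s u lim])
  moreover have "(\<lambda>n. m + inverse (Suc n)) \<longlonglongrightarrow> m + 0"
    by (intro tendsto_intros LIMSEQ_inverse_real_of_nat)
  ultimately have Qu: "Q u \<le> m"
    using sm by (intro LIMSEQ_le[where X = "\<lambda>n. Q (s n)"]) (auto intro: less_imp_le)
  have "L f = ip H f u" if f: "f \<in> funs H" for f
  proof -
    let ?d = "L f - ip H f u"
    \<comment> \<open>First variation at the minimiser. The factor \<open>cnj ?d\<close> in the
      perturbation makes the linear term real, up to sign \<open>2 * t\<close> times the squared
      modulus of \<open>?d\<close>.\<close>
    have *: "2 * t * (cmod ?d)\<^sup>2 \<le> t\<^sup>2 * ((cmod ?d)\<^sup>2 * (hnorm H f)\<^sup>2)" for t :: real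
    proof -
      let ?c = "of_real t * cnj ?d"
      have cf: "(\<lambda>z. ?c * f z) \<in> funs H" by (rule scale_mem[OF f])
      have "Q u \<le> Q (\<lambda>z. u z + ?c * f z)"
        using Qu m_le[of "\<lambda>z. u z + ?c * f z"] u cf by (auto simp: add_mem)
      also have "\<dots> = Q u + 2 * Re (ip H u (\<lambda>z. ?c * f z)) - 2 * Re (?c * L f) + (cmod ?c * hnorm H f)\<^sup>2"
        using u f cf by (simp add: Q_def add scale hnorm_add_square hnorm_scale del: times_complex.sel)
      also have "Re (ip H u (\<lambda>z. ?c * f z)) = Re (?c * ip H f u)"
        by (simp only: ip_commute[OF cf u] ip_scale[OF f u] cnj.simps)
      finally have "2 * Re (?c * ?d) \<le> (cmod ?c * hnorm H f)\<^sup>2"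
        by (simp add: algebra_simps)
      moreover have "?c * ?d = of_real (t * (cmod ?d)\<^sup>2)"
        using complex_norm_square[of ?d] by (simp add: mult.commute)
      ultimately show ?thesis
        by (simp only: Re_complex_of_real) (simp add: norm_mult power_mult_distrib del: complex_cnj_diff)
    qed
    \<comment> \<open>Small enough for the linear term to beat the quadratic one; the summand 1
      keeps the denominator positive when \<open>f\<close> has norm 0.\<close>
    let ?t = "1 / (1 + (hnorm H f)\<^sup>2)"
    have p: "1 + (hnorm H f)\<^sup>2 > 0" by (simp add: add_pos_nonneg)
    have "2 * ((1 + (hnorm H f)\<^sup>2) * (cmod ?d)\<^sup>2) \<le> (hnorm H f)\<^sup>2 * (cmod ?d)\<^sup>2"
      using *[of ?t] p by (simp add: power_divide divide_simps power2_eq_square[of "1 + (hnorm H f)\<^sup>2"]) (simp add: ac_simps)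
    then have "(2 + (hnorm H f)\<^sup>2) * (cmod ?d)\<^sup>2 \<le> 0" by (simp add: algebra_simps)
    then have "(cmod ?d)\<^sup>2 \<le> 0"
      by (simp add: mult_le_0_iff) (smt (verit) zero_le_power2)
    then show ?thesis by simp
  qed
  then show ?thesis using that u by blast
qed

end

section \<open>Subspaces spanned by kernel functions\<close>

locale drury_arveson_space = rkhs unit_ball da_kernel H
  for H :: "(complex ^ 'd) function_space"
begin

lemma kf_mem: "x \<in> unit_ball \<Longrightarrow> kf x \<in> funs H"
  unfolding kf_def by (rule kernel_mem)

lemma ip_kf: "f \<in> funs H \<Longrightarrow> x \<in> unit_ball \<Longrightarrow> ip H f (kf x) = f x"
  unfolding kf_def by (rule reproducing[symmetric])

lemma kf_apply: "x \<in> unit_ball \<Longrightarrow> kf y x = da_kernel x y"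
  by (simp add: kf_def kernel_fun_def)

lemma hnorm_kf_pos: assumes x: "x \<in> unit_ball" shows "0 < hnorm H (kf x)"
proof -
  have "kf x 0 \<noteq> 0" by (simp add: kf_apply da_kernel_def cdot_def)
  then have "hnorm H (kf x) \<noteq> 0"
    using hnorm_eq_zero[OF kf_mem[OF x]] by force
  then show ?thesis using hnorm_nonneg[OF kf_mem[OF x]] by linarith
qed

lemma subspace_on_subset: "subspace_on H V \<subseteq> funs H"
  by (auto simp: subspace_on_def)

lemma subspace_on_funs: "f \<in> subspace_on H V \<Longrightarrow> f \<in> funs H"
  by (auto simp: subspace_on_def)

lemma kcomb_mem_funs:
  "A \<subseteq> unit_ball \<Longrightarrow> (\<lambda>z. \<Sum>x\<in>A. c x * kf x z) \<in> funs H"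
  by (rule sum_mem) (auto intro: kf_mem)

lemma kcomb_mem:
  assumes "V \<subseteq> unit_ball" "finite A" "A \<subseteq> V"
  shows "(\<lambda>z. \<Sum>x\<in>A. c x * kf x z) \<in> subspace_on H V"
proof -
  have "A \<subseteq> unit_ball" using assms by blast
  then show ?thesis
    unfolding subspace_on_def using assms hnorm_zero
    by (auto simp: kcomb_mem_funs intro!: exI[of _ A] exI[of _ c])
qed

lemma kf_mem_subspace: "V \<subseteq> unit_ball \<Longrightarrow> x \<in> V \<Longrightarrow> kf x \<in> subspace_on H V"
  using kcomb_mem[of V "{x}" "\<lambda>_. 1"] by simp

lemma zero_mem_subspace: "(\<lambda>z. 0) \<in> subspace_on H V"
  unfolding subspace_on_def using zero_mem hnorm_zero
  by (auto intro!: exI[of _ "{}"])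

lemma scale_mem_subspace:
  assumes V: "V \<subseteq> unit_ball" and f: "f \<in> subspace_on H V"
  shows "(\<lambda>z. c * f z) \<in> subspace_on H V"
  unfolding subspace_on_def
proof (intro CollectI conjI allI impI)
  show "(\<lambda>z. c * f z) \<in> funs H" using f by (intro scale_mem subspace_on_funs)
  fix e :: real assume e: "e > 0"
  then have "e / (cmod c + 1) > 0" by (simp add: add_nonneg_pos)
  then obtain A a where A: "finite A" "A \<subseteq> V"
      and d: "hnorm H (\<lambda>z. f z - (\<Sum>x\<in>A. a x * kf x z)) < e / (cmod c + 1)"
    using f unfolding subspace_on_def by blast
  let ?g = "\<lambda>z. f z - (\<Sum>x\<in>A. a x * kf x z)"
  have g: "?g \<in> funs H" using A V f by (intro diff_mem kcomb_mem_funs subspace_on_funs) auto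
  have "hnorm H (\<lambda>z. c * f z - (\<Sum>x\<in>A. (c * a x) * kf x z)) = hnorm H (\<lambda>z. c * ?g z)"
    by (rule arg_cong[where f = "hnorm H"]) (auto simp: fun_eq_iff right_diff_distrib sum_distrib_left mult.assoc)
  also have "\<dots> = cmod c * hnorm H ?g" by (rule hnorm_scale[OF g])
  also have "\<dots> \<le> (cmod c + 1) * hnorm H ?g"
    by (rule mult_right_mono) (simp_all add: hnorm_nonneg g)
  also have "\<dots> < e"
    using d by (simp add: pos_less_divide_eq add_nonneg_pos mult.commute)
  finally show "\<exists>A a. finite A \<and> A \<subseteq> V \<and> hnorm H (\<lambda>z. c * f z - (\<Sum>x\<in>A. a x * kf x z)) < e"
    using A by (intro exI[of _ A] exI[of _ "\<lambda>x. c * a x"]) auto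
qed

lemma add_mem_subspace:
  assumes V: "V \<subseteq> unit_ball" and f: "f \<in> subspace_on H V" and g: "g \<in> subspace_on H V"
  shows "(\<lambda>z. f z + g z) \<in> subspace_on H V"
  unfolding subspace_on_def
proof (intro CollectI conjI allI impI)
  show "(\<lambda>z. f z + g z) \<in> funs H" using f g by (intro add_mem subspace_on_funs)
  fix e :: real assume e: "e > 0"
  then have e2: "e / 2 > 0" by simp
  obtain A a where A: "finite A" "A \<subseteq> V"
      and da: "hnorm H (\<lambda>z. f z - (\<Sum>x\<in>A. a x * kf x z)) < e / 2"
    using f e2 unfolding subspace_on_def by blast
  obtain B b where B: "finite B" "B \<subseteq> V"
      and db: "hnorm H (\<lambda>z. g z - (\<Sum>x\<in>B. b x * kf x z)) < e / 2"
    using g e2 unfolding subspace_on_def by blast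
  let ?c = "\<lambda>x. (if x \<in> A then a x else 0) + (if x \<in> B then b x else 0)"
  have split: "(\<Sum>x\<in>A \<union> B. ?c x * kf x z) = (\<Sum>x\<in>A. a x * kf x z) + (\<Sum>x\<in>B. b x * kf x z)" for z
  proof -
    have "(\<Sum>x\<in>A \<union> B. (if x \<in> A then a x else 0) * kf x z) = (\<Sum>x\<in>A. a x * kf x z)"
      using A B by (intro sum.mono_neutral_cong_right) auto
    moreover have "(\<Sum>x\<in>A \<union> B. (if x \<in> B then b x else 0) * kf x z) = (\<Sum>x\<in>B. b x * kf x z)"
      using A B by (intro sum.mono_neutral_cong_right) auto
    ultimately show ?thesis by (simp add: distrib_right sum.distrib)
  qed
  have "hnorm H (\<lambda>z. f z + g z - (\<Sum>x\<in>A \<union> B. ?c x * kf x z))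
      = hnorm H (\<lambda>z. (f z - (\<Sum>x\<in>A. a x * kf x z)) + (g z - (\<Sum>x\<in>B. b x * kf x z)))"
    unfolding split by (simp add: algebra_simps)
  also have "\<dots> \<le> hnorm H (\<lambda>z. f z - (\<Sum>x\<in>A. a x * kf x z)) + hnorm H (\<lambda>z. g z - (\<Sum>x\<in>B. b x * kf x z))"
    using A B V f g by (intro hnorm_triangle diff_mem kcomb_mem_funs subspace_on_funs) auto
  also have "\<dots> < e" using da db by linarith
  finally show "\<exists>A a. finite A \<and> A \<subseteq> V \<and> hnorm H (\<lambda>z. f z + g z - (\<Sum>x\<in>A. a x * kf x z)) < e"
    using A B by (intro exI[of _ "A \<union> B"] exI[of _ ?c]) auto
qed

lemma diff_mem_subspace:
  assumes "V \<subseteq> unit_ball" "f \<in> subspace_on H V" "g \<in> subspace_on H V"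
  shows "(\<lambda>z. f z - g z) \<in> subspace_on H V"
  using add_mem_subspace[of V f "\<lambda>z. - 1 * g z"] scale_mem_subspace[of V g "- 1"] assms by simp

lemma sum_mem_subspace:
  assumes V: "V \<subseteq> unit_ball" and f: "\<And>i. i \<in> A \<Longrightarrow> f i \<in> subspace_on H V"
  shows "(\<lambda>z. \<Sum>i\<in>A. f i z) \<in> subspace_on H V"
  using f
proof (induction A rule: infinite_finite_induct)
  case (insert i A)
  then show ?case using add_mem_subspace[OF V, of "f i" "\<lambda>z. \<Sum>i\<in>A. f i z"] by simp
qed (simp_all add: zero_mem_subspace)

text \<open>Since \<open>f\<close> is a limit of kernel combinations, pairings with them detect its
  whole norm. Such pairings are finite sums of values of \<open>f\<close>, so norm estimates reduce
  to finite sums.\<close>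

lemma subspace_hnorm_le:
  assumes V: "V \<subseteq> unit_ball" and f: "f \<in> subspace_on H V"
    and le: "\<And>A c. finite A \<Longrightarrow> A \<subseteq> V \<Longrightarrow> cmod (ip H f (\<lambda>z. \<Sum>x\<in>A. c x * kf x z))
      \<le> C * hnorm H (\<lambda>z. \<Sum>x\<in>A. c x * kf x z)"
    and C: "0 \<le> C"
  shows "hnorm H f \<le> C"
proof -
  have f': "f \<in> funs H" by (rule subspace_on_funs[OF f])
  let ?n = "hnorm H f"
  have n: "0 \<le> ?n" by (rule hnorm_nonneg[OF f'])
  have "?n\<^sup>2 \<le> C * ?n + e" if e: "e > 0" for e
  proof -
    \<comment> \<open>Makes the total error \<open>d * (?n + C + 1)\<close> exactly
      \<open>e\<close>; the 1 excludes a zero denominator.\<close>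
    define d where "d = e / (?n + C + 1)"
    have p: "?n + C + 1 > 0" using n C by linarith
    then have d: "d > 0" using e by (simp add: d_def)
    then obtain A c where A: "finite A" "A \<subseteq> V"
        and dd: "hnorm H (\<lambda>z. f z - (\<Sum>x\<in>A. c x * kf x z)) < d"
      using f unfolding subspace_on_def by blast
    let ?v = "\<lambda>z. \<Sum>x\<in>A. c x * kf x z"
    have v: "?v \<in> funs H" using A V by (intro kcomb_mem_funs) auto
    have fv: "(\<lambda>z. f z - ?v z) \<in> funs H" by (rule diff_mem[OF f' v])
    have nv: "hnorm H ?v \<le> ?n + d"
    proof -
      have "hnorm H ?v \<le> hnorm H (\<lambda>z. ?v z - f z) + ?n"
        using hnorm_triangle[OF diff_mem[OF v f'] f'] by simp
      then show ?thesis using dd hnorm_diff_commute[OF f' v] by simp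
    qed
    have "complex_of_real (?n\<^sup>2) = ip H f (\<lambda>z. f z - ?v z) + ip H f ?v"
      using f' v by (simp only: ip_diff_right ip_self[symmetric]) simp
    then have "cmod (complex_of_real (?n\<^sup>2)) \<le> cmod (ip H f (\<lambda>z. f z - ?v z)) + cmod (ip H f ?v)"
      by (simp only: norm_triangle_ineq)
    then have "?n\<^sup>2 \<le> cmod (ip H f (\<lambda>z. f z - ?v z)) + cmod (ip H f ?v)"
      by (simp only: norm_of_real abs_power2)
    also have "\<dots> \<le> ?n * d + C * (?n + d)"
    proof (rule add_mono)
      show "cmod (ip H f (\<lambda>z. f z - ?v z)) \<le> ?n * d"
        using Cauchy_Schwarz[OF f' fv] dd n by (meson less_imp_le mult_left_mono order_trans)
      show "cmod (ip H f ?v) \<le> C * (?n + d)"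
        using le[OF A, of c] nv C by (meson mult_left_mono order_trans)
    qed
    also have "\<dots> \<le> C * ?n + d * (?n + C + 1)" using d by (simp add: algebra_simps)
    also have "d * (?n + C + 1) = e" using p by (simp add: d_def)
    finally show ?thesis .
  qed
  then have "?n\<^sup>2 \<le> C * ?n" by (rule field_le_epsilon)
  then show ?thesis using n C
    by (cases "?n = 0") (simp_all add: power2_eq_square)
qed

lemma ip_kcomb:
  assumes "f \<in> funs H" "A \<subseteq> unit_ball"
  shows "ip H f (\<lambda>z. \<Sum>x\<in>A. c x * kf x z) = (\<Sum>x\<in>A. cnj (c x) * f x)"
  using assms by (subst ip_sum_right) (auto simp: kf_mem ip_kf subset_iff intro!: sum.cong)

text \<open>Vanishing on \<open>V\<close> is orthogonality to every \<open>kf x\<close> with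
  \<open>x\<close> in \<open>V\<close>, hence to the closed span and to \<open>f\<close> itself.
  Restriction to \<open>V\<close> is therefore injective on the subspace, which makes the definite
  description in \<open>mult_op\<close> meaningful.\<close>

lemma subspace_eq_zero:
  assumes V: "V \<subseteq> unit_ball" and f: "f \<in> subspace_on H V" and zero: "\<And>x. x \<in> V \<Longrightarrow> f x = 0"
  shows "f = (\<lambda>z. 0)"
proof -
  have "hnorm H f \<le> 0"
  proof (rule subspace_hnorm_le[OF V f])
    fix A c assume A: "finite A" "A \<subseteq> V"
    then have "ip H f (\<lambda>z. \<Sum>x\<in>A. c x * kf x z) = 0"
      using ip_kcomb[OF subspace_on_funs[OF f], of A c] V zero by (auto intro!: sum.neutral)
    then show "cmod (ip H f (\<lambda>z. \<Sum>x\<in>A. c x * kf x z)) \<le> 0 * hnorm H (\<lambda>z. \<Sum>x\<in>A. c x * kf x z)"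
      by simp
  qed simp
  then show ?thesis
    using hnorm_nonneg[OF subspace_on_funs[OF f]] hnorm_eq_zero[OF subspace_on_funs[OF f]] by simp
qed

lemma subspace_eqI:
  assumes "V \<subseteq> unit_ball" "f \<in> subspace_on H V" "g \<in> subspace_on H V"
    and "\<And>x. x \<in> V \<Longrightarrow> f x = g x"
  shows "f = g"
  using subspace_eq_zero[OF assms(1) diff_mem_subspace[OF assms(1-3)]] assms(4)
  by (auto simp: fun_eq_iff)

text \<open>The point is closedness. Riesz representation then applies inside the subspace, so
  representing elements lie in it. The base set stays the ball because elements are not restricted
  to \<open>V\<close>.\<close>

lemma subspace_hilbert_function_space:
  assumes V: "V \<subseteq> unit_ball"
  shows "hilbert_function_space unit_ball \<lparr>funs = subspace_on H V, ip = ip H\<rparr>"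
proof -
  let ?S = "\<lparr>funs = subspace_on H V, ip = ip H\<rparr>"
  have hn: "hnorm ?S = hnorm H" by (simp add: hnorm_def fun_eq_iff)
  note mem = subspace_on_funs
  show ?thesis
  proof (unfold_locales, unfold hn function_space.simps)
    fix s :: "nat \<Rightarrow> complex ^ 'd \<Rightarrow> complex"
    assume s: "\<And>n. s n \<in> subspace_on H V"
      and C: "\<And>e. e > 0 \<Longrightarrow> \<exists>N. \<forall>m\<ge>N. \<forall>n\<ge>N. hnorm H (\<lambda>x. s m x - s n x) < e"
    obtain f where f: "f \<in> funs H" and lim: "(\<lambda>n. hnorm H (\<lambda>x. s n x - f x)) \<longlonglongrightarrow> 0"
      using complete[of s, OF mem[OF s] C] by blast
    have "\<exists>A c. finite A \<and> A \<subseteq> V \<and> hnorm H (\<lambda>z. f z - (\<Sum>x\<in>A. c x * kf x z)) < e"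
      if "e > 0" for e
    proof -
      have e2: "e / 2 > 0" using that by simp
      obtain n where n: "hnorm H (\<lambda>x. s n x - f x) < e / 2"
        using order_tendstoD(2)[OF lim e2] by (auto simp: eventually_sequentially)
      obtain A c where A: "finite A" "A \<subseteq> V"
          and d: "hnorm H (\<lambda>z. s n z - (\<Sum>x\<in>A. c x * kf x z)) < e / 2"
        using s[of n] e2 unfolding subspace_on_def by blast
      have k: "(\<lambda>z. \<Sum>x\<in>A. c x * kf x z) \<in> funs H" using A V by (intro kcomb_mem_funs) auto
      have "hnorm H (\<lambda>z. f z - (\<Sum>x\<in>A. c x * kf x z))
          \<le> hnorm H (\<lambda>z. f z - s n z) + hnorm H (\<lambda>z. s n z - (\<Sum>x\<in>A. c x * kf x z))"
        using hnorm_triangle[OF diff_mem[OF f mem[OF s[of n]]] diff_mem[OF mem[OF s[of n]] k]] by simp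
      then show ?thesis
        using A d n hnorm_diff_commute[OF f mem[OF s[of n]]] by (intro exI[of _ A] exI[of _ c]) auto
    qed
    then have "f \<in> subspace_on H V" using f by (auto simp: subspace_on_def)
    then show "\<exists>f\<in>subspace_on H V. (\<lambda>n. hnorm H (\<lambda>x. s n x - f x)) \<longlonglongrightarrow> 0"
      using lim by blast
  qed (auto intro: zero_outside add_mem_subspace[OF V] scale_mem_subspace[OF V] zero_mem_subspace
      ip_add ip_scale ip_commute ip_nonneg ip_definite mem)
qed

lemma mult_op:
  assumes V: "V \<subseteq> unit_ball" and f: "f \<in> mult_alg H V" and h: "h \<in> subspace_on H V"
  shows mult_op_mem: "mult_op H V f h \<in> subspace_on H V"
    and mult_op_apply: "\<And>x. x \<in> V \<Longrightarrow> mult_op H V f h x = f x * h x"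
proof -
  have "\<exists>!g. g \<in> subspace_on H V \<and> (\<forall>x\<in>V. g x = f x * h x)"
  proof (rule ex_ex1I)
    show "\<exists>g. g \<in> subspace_on H V \<and> (\<forall>x\<in>V. g x = f x * h x)"
      using f h unfolding mult_alg_def by blast
  qed (rule subspace_eqI[OF V], auto)
  from theI'[OF this] show "mult_op H V f h \<in> subspace_on H V"
      "\<And>x. x \<in> V \<Longrightarrow> mult_op H V f h x = f x * h x"
    unfolding mult_op_def by auto
qed

end

section \<open>Vector valued multipliers\<close>

lemma cmod_cdot_le: "cmod (cdot x y) \<le> norm x * norm y"
proof -
  have "cmod (cdot x y) \<le> (\<Sum>i\<in>UNIV. \<bar>cmod (x $ i)\<bar> * \<bar>cmod (y $ i)\<bar>)"
    unfolding cdot_def by (rule sum_norm_le) (simp add: norm_mult)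
  also have "\<dots> \<le> norm x * norm y"
    unfolding norm_vec_def by (rule L2_set_mult_ineq)
  finally show ?thesis .
qed

lemma cmod_cdot_less: assumes "x \<in> unit_ball" "y \<in> unit_ball" shows "cmod (cdot x y) < 1"
proof -
  have "norm x * norm y < 1"
    using assms by (simp, metis mult_strict_mono norm_ge_zero mult_1 zero_less_one)
  then show ?thesis using cmod_cdot_le[of x y] by linarith
qed

lemma norm_vec_square: "(norm (x :: complex ^ 'd))\<^sup>2 = (\<Sum>i\<in>UNIV. (cmod (x $ i))\<^sup>2)"
  by (simp add: norm_vec_def L2_set_def sum_nonneg)

lemma cdot_self: "cdot x x = of_real ((norm x)\<^sup>2)"
  unfolding cdot_def norm_vec_square by (simp add: complex_norm_square del: of_real_power)

lemma cdot_mult_da_kernel: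
  assumes "x \<in> unit_ball" "y \<in> unit_ball"
  shows "cdot x y * da_kernel x y = da_kernel x y - 1"
proof -
  have "cdot x y \<noteq> 1" using cmod_cdot_less[OF assms] by auto
  then show ?thesis by (simp add: da_kernel_def field_simps)
qed

text \<open>The determinant is monotone on positive 2 by 2 Hermitian matrices. If the difference has
  diagonal \<open>a\<close>, \<open>b\<close> and off-diagonal entry \<open>e\<close>, the
  determinant grows by \<open>a * b - (cmod e)\<^sup>2\<close> plus the mixed term
  \<open>a * q0 + b * p0 - 2 * Re (w0 * cnj e)\<close>; both are nonnegative.\<close>

lemma hermitian_det_mono:
  fixes p q p0 q0 :: real and w w0 :: complex
  assumes le: "\<And>s t. p0 * (cmod s)\<^sup>2 + q0 * (cmod t)\<^sup>2 + 2 * Re (s * cnj t * w0)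
      \<le> p * (cmod s)\<^sup>2 + q * (cmod t)\<^sup>2 + 2 * Re (s * cnj t * w)"
    and p0: "0 \<le> p0" and q0: "0 \<le> q0" and w0: "(cmod w0)\<^sup>2 \<le> p0 * q0"
  shows "p0 * q0 - (cmod w0)\<^sup>2 \<le> p * q - (cmod w)\<^sup>2"
proof -
  define a b e where "a = p - p0" and "b = q - q0" and "e = w - w0"
  have form: "0 \<le> a * (cmod s)\<^sup>2 + b * (cmod t)\<^sup>2 + 2 * Re (s * cnj t * e)" for s t
    using le[of s t] by (simp add: a_def b_def e_def algebra_simps)
  have a: "0 \<le> a" using form[of 1 0] by simp
  have b: "0 \<le> b" using form[of 0 1] by simp
  have ee: "cnj e * e = of_real ((cmod e)\<^sup>2)" using complex_norm_square[of e] by (simp add: mult.commute)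
  \<comment> \<open>Taking \<open>s = - u * cnj e\<close> removes the phase of \<open>e\<close>, so
    the cross term becomes real.\<close>
  have form': "0 \<le> a * (u\<^sup>2 * (cmod e)\<^sup>2) + b * t\<^sup>2 - 2 * (u * t * (cmod e)\<^sup>2)" for u t :: real
  proof -
    have "- of_real u * cnj e * cnj (of_real t) * e = - of_real (u * t) * (cnj e * e)" by simp
    also have "\<dots> = of_real (- (u * t * (cmod e)\<^sup>2))" by (simp add: ee)
    finally have "Re (- of_real u * cnj e * cnj (of_real t) * e) = - (u * t * (cmod e)\<^sup>2)"
      by (simp only: Re_complex_of_real)
    then show ?thesis
      using form[of "- of_real u * cnj e" "of_real t"] by (simp add: norm_mult power_mult_distrib)
  qed
  have e: "(cmod e)\<^sup>2 \<le> a * b"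
  proof (cases "a = 0")
    case True
    \<comment> \<open>For \<open>a = 0\<close> the form is unbounded below unless
      \<open>e = 0\<close>; this choice of \<open>u\<close> gives it the negative value
      \<open>- b - 2\<close>.\<close>
    have "0 \<le> b - 2 * ((b + 1) * (cmod e)\<^sup>2) / (cmod e)\<^sup>2" if "cmod e \<noteq> 0"
      using form'[of "(b + 1) / (cmod e)\<^sup>2" 1] True that by simp
    then show ?thesis using True b by (cases "cmod e = 0") auto
  next
    case False
    \<comment> \<open>At \<open>u = 1\<close>, \<open>t = a\<close> the form equals \<open>a\<close>
      times the determinant of the difference.\<close>
    have "a * (cmod e)\<^sup>2 \<le> a * (a * b)" using form'[of 1 a] by (simp add: power2_eq_square algebra_simps)
    then show ?thesis using a False by (simp add: mult_le_cancel_left)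
  qed
  \<comment> \<open>The product \<open>cmod w0 * cmod e\<close> is at most the geometric mean of
    \<open>a * q0\<close> and \<open>b * p0\<close>, hence at most their arithmetic mean.\<close>
  have "2 * Re (w0 * cnj e) \<le> a * q0 + b * p0"
  proof -
    have "(2 * (cmod w0 * cmod e))\<^sup>2 \<le> (a * q0 + b * p0)\<^sup>2"
    proof -
      have "(2 * (cmod w0 * cmod e))\<^sup>2 = 4 * ((cmod w0)\<^sup>2 * (cmod e)\<^sup>2)" by (simp add: power_mult_distrib)
      also have "\<dots> \<le> 4 * ((p0 * q0) * (a * b))"
        using w0 e p0 q0 by (intro mult_left_mono mult_mono) auto
      also have "\<dots> \<le> (a * q0 + b * p0)\<^sup>2"
        using zero_le_power2[of "a * q0 - b * p0"] by (simp add: power2_eq_square algebra_simps)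
      finally show ?thesis .
    qed
    then have "2 * (cmod w0 * cmod e) \<le> a * q0 + b * p0"
      using a b p0 q0 by (intro power2_le_imp_le[of "2 * (cmod w0 * cmod e)"]) auto
    moreover have "\<bar>Re (w0 * cnj e)\<bar> \<le> cmod w0 * cmod e"
      using abs_Re_le_cmod[of "w0 * cnj e"] by (simp add: norm_mult)
    ultimately show ?thesis by linarith
  qed
  moreover have "(cmod w)\<^sup>2 = (cmod w0)\<^sup>2 + (cmod e)\<^sup>2 + 2 * Re (w0 * cnj e)"
  proof -
    have w: "w = w0 + e" by (simp add: e_def)
    show ?thesis unfolding w cmod_power2 by (simp add: power2_eq_square algebra_simps)
  qed
  moreover have "p * q = p0 * q0 + a * q0 + b * p0 + a * b"
    by (simp add: a_def b_def algebra_simps)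
  ultimately show ?thesis using e by linarith
qed

section \<open>Row norms tested on kernel combinations, and overlaps of kernel functions\<close>

context drury_arveson_space
begin

lemma hnorm_lincomb_square:
  assumes f: "f \<in> funs H" and g: "g \<in> funs H"
  shows "(hnorm H (\<lambda>z. s * f z + t * g z))\<^sup>2
    = (hnorm H f)\<^sup>2 * (cmod s)\<^sup>2 + (hnorm H g)\<^sup>2 * (cmod t)\<^sup>2 + 2 * Re (s * cnj t * ip H f g)"
  using f g by (simp add: hnorm_add_square scale_mem hnorm_scale ip_scale ip_scale_right power_mult_distrib
      mult.assoc mult.commute[of "(hnorm H _)\<^sup>2"] del: times_complex.sel)

lemma ip_kf_kf: "x \<in> unit_ball \<Longrightarrow> y \<in> unit_ball \<Longrightarrow> ip H (kf x) (kf y) = da_kernel y x"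
  by (simp add: ip_kf kf_mem kf_apply)

lemma hnorm_kf_square: assumes "x \<in> unit_ball" shows "(hnorm H (kf x))\<^sup>2 = 1 / (1 - (norm x)\<^sup>2)"
proof -
  have "complex_of_real ((hnorm H (kf x))\<^sup>2) = of_real (1 / (1 - (norm x)\<^sup>2))"
    using assms by (simp add: ip_self[symmetric] kf_mem ip_kf_kf da_kernel_def cdot_self del: of_real_power)
  then show ?thesis by (simp only: of_real_eq_iff)
qed

lemma gram_kcomb:
  assumes "p ` A \<subseteq> unit_ball"
  shows "complex_of_real ((hnorm H (\<lambda>z. \<Sum>x\<in>A. b x * kf (p x) z))\<^sup>2)
    = (\<Sum>x\<in>A. \<Sum>y\<in>A. b x * cnj (b y) * da_kernel (p y) (p x))"
proof -
  have m: "kf (p x) \<in> funs H" if "x \<in> A" for x using that assms by (intro kf_mem) auto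
  have "complex_of_real ((hnorm H (\<lambda>z. \<Sum>x\<in>A. b x * kf (p x) z))\<^sup>2)
      = ip H (\<lambda>z. \<Sum>x\<in>A. b x * kf (p x) z) (\<lambda>z. \<Sum>x\<in>A. b x * kf (p x) z)"
    using sum_mem[of A "\<lambda>x. kf (p x)" b] m by (simp only: ip_self)
  also have "\<dots> = (\<Sum>x\<in>A. b x * (\<Sum>y\<in>A. cnj (b y) * ip H (kf (p x)) (kf (p y))))"
    using m sum_mem[of A "\<lambda>x. kf (p x)" b] by (simp add: ip_sum ip_sum_right)
  also have "\<dots> = (\<Sum>x\<in>A. \<Sum>y\<in>A. b x * cnj (b y) * da_kernel (p y) (p x))"
    unfolding sum_distrib_left
    using assms by (intro sum.cong refl) (simp add: ip_kf_kf image_subset_iff)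
  finally show ?thesis .
qed

text \<open>The coordinate functions form a row contraction because \<open>cdot x y * da_kernel x y\<close>
  differs from \<open>da_kernel x y\<close> by the positive kernel \<open>1\<close>.\<close>

lemma coordinate_row_contraction:
  fixes p :: "'b \<Rightarrow> complex ^ 'd"
  assumes p: "p ` A \<subseteq> unit_ball"
  shows "(\<Sum>i\<in>UNIV. (hnorm H (\<lambda>z. \<Sum>x\<in>A. (b x * cnj (p x $ i)) * kf (p x) z))\<^sup>2)
    \<le> (hnorm H (\<lambda>z. \<Sum>x\<in>A. b x * kf (p x) z))\<^sup>2" (is "?l \<le> ?r")
proof -
  have "complex_of_real ?l = (\<Sum>i\<in>UNIV. \<Sum>x\<in>A. \<Sum>y\<in>A.
      (b x * cnj (p x $ i)) * cnj (b y * cnj (p y $ i)) * da_kernel (p y) (p x))"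
    unfolding of_real_sum gram_kcomb[OF p] ..
  also have "\<dots> = (\<Sum>x\<in>A. \<Sum>i\<in>UNIV. \<Sum>y\<in>A.
      (b x * cnj (p x $ i)) * cnj (b y * cnj (p y $ i)) * da_kernel (p y) (p x))"
    by (rule sum.swap)
  also have "\<dots> = (\<Sum>x\<in>A. \<Sum>y\<in>A. \<Sum>i\<in>UNIV.
      (b x * cnj (p x $ i)) * cnj (b y * cnj (p y $ i)) * da_kernel (p y) (p x))"
    by (intro sum.cong refl sum.swap)
  also have "\<dots> = (\<Sum>x\<in>A. \<Sum>y\<in>A. b x * cnj (b y) * (cdot (p y) (p x) * da_kernel (p y) (p x)))"
    by (intro sum.cong refl) (simp add: cdot_def sum_distrib_left sum_distrib_right algebra_simps)
  also have "\<dots> = (\<Sum>x\<in>A. \<Sum>y\<in>A. b x * cnj (b y) * (da_kernel (p y) (p x) - 1))"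
    using p by (intro sum.cong refl) (simp add: cdot_mult_da_kernel image_subset_iff)
  also have "\<dots> = complex_of_real ?r - (\<Sum>x\<in>A. b x) * cnj (\<Sum>x\<in>A. b x)"
    unfolding gram_kcomb[OF p] by (simp add: right_diff_distrib sum_subtractf sum_product)
  also have "\<dots> = complex_of_real (?r - (cmod (\<Sum>x\<in>A. b x))\<^sup>2)"
    by (simp add: complex_norm_square[symmetric] del: cnj_sum)
  finally have "?l = ?r - (cmod (\<Sum>x\<in>A. b x))\<^sup>2" by (simp only: of_real_eq_iff)
  then show ?thesis by simp
qed

text \<open>The adjoint of the row operator sends \<open>kf x\<close> to the column with entries
  \<open>cnj (F x $ i) * kf x\<close>. Working with pairings avoids constructing that adjoint as an
  operator.\<close>

lemma row_pairing:
  assumes V: "V \<subseteq> unit_ball" and F: "vector_multiplier H V F"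
    and h: "\<And>i. h i \<in> subspace_on H V" and A: "A \<subseteq> V"
  shows "ip H (\<lambda>z. \<Sum>i\<in>UNIV. mult_op H V (component V F i) (h i) z) (\<lambda>z. \<Sum>x\<in>A. c x * kf x z)
    = (\<Sum>i\<in>UNIV. ip H (h i) (\<lambda>z. \<Sum>x\<in>A. (c x * cnj (F x $ i)) * kf x z))"
proof -
  have m: "component V F i \<in> mult_alg H V" for i using F by (simp add: vector_multiplier_def)
  have AB: "A \<subseteq> unit_ball" using A V by blast
  let ?g = "\<lambda>z. \<Sum>i\<in>UNIV. mult_op H V (component V F i) (h i) z"
  have g: "?g \<in> funs H"
    by (intro subspace_on_funs[of _ V] sum_mem_subspace[OF V] mult_op_mem[OF V m h])
  have "ip H ?g (\<lambda>z. \<Sum>x\<in>A. c x * kf x z) = (\<Sum>x\<in>A. cnj (c x) * ?g x)"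
    by (rule ip_kcomb[OF g AB])
  also have "\<dots> = (\<Sum>x\<in>A. \<Sum>i\<in>UNIV. cnj (c x * cnj (F x $ i)) * h i x)"
  proof (intro sum.cong refl)
    fix x assume "x \<in> A"
    then have "mult_op H V (component V F i) (h i) x = F x $ i * h i x" for i
      using A mult_op_apply[OF V m h, of x i i] by (auto simp: component_def)
    then show "cnj (c x) * ?g x = (\<Sum>i\<in>UNIV. cnj (c x * cnj (F x $ i)) * h i x)"
      by (simp add: sum_distrib_left mult.assoc)
  qed
  also have "\<dots> = (\<Sum>i\<in>UNIV. \<Sum>x\<in>A. cnj (c x * cnj (F x $ i)) * h i x)"
    by (rule sum.swap)
  also have "\<dots> = (\<Sum>i\<in>UNIV. ip H (h i) (\<lambda>z. \<Sum>x\<in>A. (c x * cnj (F x $ i)) * kf x z))"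
    by (intro sum.cong refl ip_kcomb[symmetric] AB subspace_on_funs[OF h])
  finally show ?thesis .
qed

text \<open>A row has the norm of its adjoint column, and the column is explicit on kernel
  combinations. This direction is Cauchy-Schwarz, in \<open>H\<close> and then over the
  indices.\<close>

lemma vector_mult_norm_leI:
  assumes V: "V \<subseteq> unit_ball" and F: "vector_multiplier H V F" and r: "0 \<le> r"
    and le: "\<And>A c. finite A \<Longrightarrow> A \<subseteq> V \<Longrightarrow>
      (\<Sum>i\<in>UNIV. (hnorm H (\<lambda>z. \<Sum>x\<in>A. (c x * cnj (F x $ i)) * kf x z))\<^sup>2)
        \<le> (r * hnorm H (\<lambda>z. \<Sum>x\<in>A. c x * kf x z))\<^sup>2"
  shows "vector_mult_norm H V F \<le> ennreal r"
  unfolding vector_mult_norm_def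
proof (rule SUP_least, elim CollectE conjE)
  fix h :: "'d \<Rightarrow> complex ^ 'd \<Rightarrow> complex"
  assume "\<forall>i. h i \<in> subspace_on H V" and h1: "sqrt (\<Sum>i\<in>UNIV. (hnorm H (h i))\<^sup>2) \<le> 1"
  then have h: "h i \<in> subspace_on H V" for i by blast
  have m: "component V F i \<in> mult_alg H V" for i using F by (simp add: vector_multiplier_def)
  let ?g = "\<lambda>z. \<Sum>i\<in>UNIV. mult_op H V (component V F i) (h i) z"
  have g: "?g \<in> subspace_on H V" by (intro sum_mem_subspace[OF V] mult_op_mem[OF V m h])
  have "hnorm H ?g \<le> r"
  proof (rule subspace_hnorm_le[OF V g _ r])
    fix A c assume A: "finite A" "A \<subseteq> V"
    then have AB: "A \<subseteq> unit_ball" using V by blast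
    let ?v = "\<lambda>z. \<Sum>x\<in>A. c x * kf x z"
    let ?w = "\<lambda>i z. \<Sum>x\<in>A. (c x * cnj (F x $ i)) * kf x z"
    have w: "?w i \<in> funs H" for i by (rule kcomb_mem_funs[OF AB])
    have "cmod (ip H ?g ?v) \<le> (\<Sum>i\<in>UNIV. \<bar>hnorm H (h i)\<bar> * \<bar>hnorm H (?w i)\<bar>)"
      unfolding row_pairing[OF V F h A(2)]
      by (rule sum_norm_le) (use Cauchy_Schwarz[OF subspace_on_funs[OF h] w]
          hnorm_nonneg[OF subspace_on_funs[OF h]] hnorm_nonneg[OF w] in simp)
    also have "\<dots> \<le> sqrt (\<Sum>i\<in>UNIV. (hnorm H (h i))\<^sup>2) * sqrt (\<Sum>i\<in>UNIV. (hnorm H (?w i))\<^sup>2)"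
      using L2_set_mult_ineq unfolding L2_set_def .
    also have "\<dots> \<le> 1 * (r * hnorm H ?v)"
    proof (rule mult_mono[OF h1])
      show "sqrt (\<Sum>i\<in>UNIV. (hnorm H (?w i))\<^sup>2) \<le> r * hnorm H ?v"
        using le[OF A, of c] r hnorm_nonneg[OF kcomb_mem_funs[OF AB, of c]] by (intro real_le_lsqrt) auto
    qed (auto intro: sum_nonneg)
    finally show "cmod (ip H ?g ?v) \<le> r * hnorm H ?v" by simp
  qed
  then show "ennreal (hnorm H ?g) \<le> ennreal r" by (rule ennreal_leI)
qed

lemma vector_mult_norm_leD:
  assumes V: "V \<subseteq> unit_ball" and F: "vector_multiplier H V F" and r: "0 \<le> r"
    and le: "vector_mult_norm H V F \<le> ennreal r" and A: "finite A" "A \<subseteq> V"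
  shows "(\<Sum>i\<in>UNIV. (hnorm H (\<lambda>z. \<Sum>x\<in>A. (c x * cnj (F x $ i)) * kf x z))\<^sup>2)
        \<le> (r * hnorm H (\<lambda>z. \<Sum>x\<in>A. c x * kf x z))\<^sup>2"
proof -
  have AB: "A \<subseteq> unit_ball" using V A by blast
  have m: "component V F i \<in> mult_alg H V" for i using F by (simp add: vector_multiplier_def)
  let ?v = "\<lambda>z. \<Sum>x\<in>A. c x * kf x z"
  let ?w = "\<lambda>i z. \<Sum>x\<in>A. (c x * cnj (F x $ i)) * kf x z"
  let ?S = "\<Sum>i\<in>UNIV. (hnorm H (?w i))\<^sup>2"
  have v: "?v \<in> funs H" and w: "?w i \<in> funs H" for i by (rule kcomb_mem_funs[OF AB])+
  have wV: "?w i \<in> subspace_on H V" for i by (rule kcomb_mem[OF V A])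
  define s where "s = sqrt ?S"
  have S: "?S = s\<^sup>2" unfolding s_def by (simp add: sum_nonneg)
  have s0: "0 \<le> s" unfolding s_def by (simp add: sum_nonneg)
  have "s \<le> r * hnorm H ?v"
  proof (cases "s = 0")
    case True
    then show ?thesis using r hnorm_nonneg[OF v] by simp
  next
    case False
    with s0 have s: "0 < s" by simp
    \<comment> \<open>The extremal tuple is the normalised column itself: its pairing with
      \<open>?v\<close> equals \<open>s\<close>.\<close>
    define h where "h i = (\<lambda>z. of_real (1 / s) * ?w i z)" for i
    have h: "h i \<in> subspace_on H V" for i
      unfolding h_def by (rule scale_mem_subspace[OF V wV])
    have "(hnorm H (h i))\<^sup>2 = (1 / s\<^sup>2) * (hnorm H (?w i))\<^sup>2" for i
      unfolding h_def hnorm_scale[OF w] using s by (simp add: power_divide norm_divide)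
    then have h1: "sqrt (\<Sum>i\<in>UNIV. (hnorm H (h i))\<^sup>2) \<le> 1"
      using s by (simp add: sum_divide_distrib[symmetric] S)
    let ?g = "\<lambda>z. \<Sum>i\<in>UNIV. mult_op H V (component V F i) (h i) z"
    have g: "?g \<in> funs H"
      by (intro subspace_on_funs[of _ V] sum_mem_subspace[OF V] mult_op_mem[OF V m h])
    have "ennreal (hnorm H ?g) \<le> vector_mult_norm H V F"
      unfolding vector_mult_norm_def using h h1 by (intro SUP_upper) auto
    with le have "ennreal (hnorm H ?g) \<le> ennreal r" by (rule order_trans[rotated])
    then have gr: "hnorm H ?g \<le> r" using r by simp
    have "ip H ?g ?v = (\<Sum>i\<in>UNIV. of_real (1 / s) * of_real ((hnorm H (?w i))\<^sup>2))"
      unfolding row_pairing[OF V F h A(2)]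
      by (intro sum.cong refl) (simp only: h_def ip_scale[OF w w] ip_self[OF w])
    also have "\<dots> = of_real (1 / s * ?S)"
      by (simp only: of_real_mult of_real_sum sum_distrib_left)
    also have "1 / s * ?S = s" unfolding S using s by (simp add: power2_eq_square)
    finally have "s = cmod (ip H ?g ?v)" using s by simp
    also have "\<dots> \<le> hnorm H ?g * hnorm H ?v" by (rule Cauchy_Schwarz[OF g v])
    also have "\<dots> \<le> r * hnorm H ?v" using gr hnorm_nonneg[OF v] by (rule mult_right_mono)
    finally show ?thesis .
  qed
  then show ?thesis unfolding S using s0 by (rule power_mono)
qed

text \<open>One minus the overlap is the square of the pseudohyperbolic distance.\<close>

definition overlap :: "complex ^ 'd \<Rightarrow> complex ^ 'd \<Rightarrow> real" where
  "overlap x y = (cmod (ip H (kf x) (kf y)))\<^sup>2 / ((hnorm H (kf x))\<^sup>2 * (hnorm H (kf y))\<^sup>2)"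

lemma overlap_mult:
  assumes "x \<in> unit_ball" "y \<in> unit_ball"
  shows "(cmod (ip H (kf x) (kf y)))\<^sup>2 = overlap x y * ((hnorm H (kf x))\<^sup>2 * (hnorm H (kf y))\<^sup>2)"
  using hnorm_kf_pos[OF assms(1)] hnorm_kf_pos[OF assms(2)] by (simp add: overlap_def)

text \<open>The standard identity for the pseudohyperbolic distance of the ball. In product form it
  converts the diagonal entries of a 2 by 2 determinant into an overlap.\<close>

lemma overlap_eq:
  assumes x: "x \<in> unit_ball" and y: "y \<in> unit_ball"
  shows "overlap x y * (cmod (1 - cdot y x))\<^sup>2 = (1 - (norm x)\<^sup>2) * (1 - (norm y)\<^sup>2)"
proof -
  have "1 - cdot y x \<noteq> 0" using cmod_cdot_less[OF y x] by auto
  moreover have "(norm x)\<^sup>2 < 1" "(norm y)\<^sup>2 < 1"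
    using x y by (simp_all add: power_less_one_iff)
  ultimately show ?thesis
    using x y unfolding overlap_def
    by (simp add: ip_kf_kf hnorm_kf_square da_kernel_def norm_divide power_divide)
qed

lemma overlap_le_1: assumes x: "x \<in> unit_ball" and y: "y \<in> unit_ball" shows "overlap x y \<le> 1"
proof -
  have "(cmod (ip H (kf x) (kf y)))\<^sup>2 \<le> (hnorm H (kf x) * hnorm H (kf y))\<^sup>2"
    using Cauchy_Schwarz[OF kf_mem[OF x] kf_mem[OF y]] by (intro power_mono) auto
  then show ?thesis
    using hnorm_kf_pos[OF x] hnorm_kf_pos[OF y] by (simp add: overlap_def power_mult_distrib)
qed

text \<open>Equality in Cauchy-Schwarz makes the two kernel functions proportional; at 0 both are 1,
  so they coincide. Then \<open>cdot z x = cdot z y\<close> on the ball, and the cases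
  \<open>z = x\<close> and \<open>z = y\<close> give \<open>x = y\<close>.\<close>

lemma overlap_less_1:
  assumes x: "x \<in> unit_ball" and y: "y \<in> unit_ball" and "x \<noteq> y"
  shows "overlap x y < 1"
proof (rule ccontr)
  assume "\<not> overlap x y < 1"
  then have one: "overlap x y = 1" using overlap_le_1[OF x y] by simp
  let ?c = "ip H (kf x) (kf y) / of_real ((hnorm H (kf y))\<^sup>2)"
  let ?u = "\<lambda>z. kf x z - ?c * kf y z"
  have "(hnorm H (kf y))\<^sup>2 * (hnorm H ?u)\<^sup>2 = 0"
    using hnorm_diff_proj[OF kf_mem[OF x] kf_mem[OF y]] overlap_mult[OF x y] one by simp
  then have "hnorm H ?u = 0" using hnorm_kf_pos[OF y] by simp
  moreover have "?u \<in> funs H" using x y by (intro diff_mem scale_mem kf_mem)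
  ultimately have "?u = (\<lambda>z. 0)" by (rule hnorm_eq_zero[rotated])
  then have u: "kf x z = ?c * kf y z" for z by (simp add: fun_eq_iff)
  have "?c = 1" using u[of 0] by (simp add: kf_apply da_kernel_def cdot_def)
  then have eq: "da_kernel z x = da_kernel z y" if "z \<in> unit_ball" for z
    using u[of z] that by (simp add: kf_apply)
  have c: "cdot z x = cdot z y" if z: "z \<in> unit_ball" for z
  proof -
    have "1 - cdot z x \<noteq> 0" "1 - cdot z y \<noteq> 0"
      using cmod_cdot_less[OF z x] cmod_cdot_less[OF z y] by auto
    then show ?thesis using eq[OF z] by (simp add: da_kernel_def)
  qed
  have "cdot (x - y) (x - y) = cdot x x - cdot x y - (cdot y x - cdot y y)"
    by (simp add: cdot_def sum_subtractf sum.distrib algebra_simps)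
  then have "cdot (x - y) (x - y) = 0" using c[OF x] c[OF y] by simp
  then show False using \<open>x \<noteq> y\<close> by (simp add: cdot_self)
qed

text \<open>If the row norm of \<open>F\<close> is at most \<open>r\<close>, then \<open>(1 - cdot (F x) (F y)) * da_kernel x y\<close>
  dominates \<open>(1 - r\<^sup>2) * da_kernel x y\<close> as a kernel; compare determinants on \<open>{x, y}\<close>.\<close>

lemma overlap_gap:
  assumes V: "V \<subseteq> unit_ball" and F: "vector_multiplier H V F" and r: "0 \<le> r" "r \<le> 1"
    and le: "vector_mult_norm H V F \<le> ennreal r"
    and xy: "x \<in> V" "y \<in> V" "x \<noteq> y" and FB: "F x \<in> unit_ball" "F y \<in> unit_ball"
  shows "(1 - r\<^sup>2)\<^sup>2 * (1 - overlap x y) \<le> 4 * (overlap (F x) (F y) - overlap x y)"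
proof -
  have B: "x \<in> unit_ball" "y \<in> unit_ball" using V xy by auto
  let ?a = "(hnorm H (kf x))\<^sup>2" and ?b = "(hnorm H (kf y))\<^sup>2" and ?k = "ip H (kf x) (kf y)"
  let ?g = "cdot (F y) (F x)"
  have kx: "kf x \<in> funs H" and ky: "kf y \<in> funs H" using B by (auto intro: kf_mem)
  have r1: "0 \<le> 1 - r\<^sup>2" using r by (simp add: power_le_one)
  have pos: "0 < ?a * ?b" using hnorm_kf_pos[OF B(1)] hnorm_kf_pos[OF B(2)] by simp
  have "((1 - r\<^sup>2) * ?a) * ((1 - r\<^sup>2) * ?b) - (cmod (of_real (1 - r\<^sup>2) * ?k))\<^sup>2
    \<le> ((1 - (norm (F x))\<^sup>2) * ?a) * ((1 - (norm (F y))\<^sup>2) * ?b) - (cmod ((1 - ?g) * ?k))\<^sup>2"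
  proof (rule hermitian_det_mono)
    fix s t :: complex
    let ?N = "?a * (cmod s)\<^sup>2 + ?b * (cmod t)\<^sup>2 + 2 * Re (s * cnj t * ?k)"
    let ?c = "\<lambda>z. if z = x then s else t"
    have "(\<Sum>i\<in>UNIV. (hnorm H (\<lambda>z. (s * cnj (F x $ i)) * kf x z + (t * cnj (F y $ i)) * kf y z))\<^sup>2)
        \<le> (r * hnorm H (\<lambda>z. s * kf x z + t * kf y z))\<^sup>2"
      using vector_mult_norm_leD[OF V F r(1) le, of "{x, y}" ?c] xy by auto
    also have "\<dots> = r\<^sup>2 * ?N" by (simp only: power_mult_distrib hnorm_lincomb_square[OF kx ky])
    also have "(\<Sum>i\<in>UNIV. (hnorm H (\<lambda>z. (s * cnj (F x $ i)) * kf x z + (t * cnj (F y $ i)) * kf y z))\<^sup>2)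
      = ?a * (cmod s)\<^sup>2 * (norm (F x))\<^sup>2 + ?b * (cmod t)\<^sup>2 * (norm (F y))\<^sup>2 + 2 * Re (s * cnj t * (?g * ?k))"
    proof -
      have "(\<Sum>i\<in>UNIV. 2 * Re (s * cnj (F x $ i) * cnj (t * cnj (F y $ i)) * ?k))
          = 2 * Re (\<Sum>i\<in>UNIV. s * cnj (F x $ i) * cnj (t * cnj (F y $ i)) * ?k)"
        by (simp only: Re_sum sum_distrib_left)
      also have "(\<Sum>i\<in>UNIV. s * cnj (F x $ i) * cnj (t * cnj (F y $ i)) * ?k) = s * cnj t * (?g * ?k)"
        unfolding cdot_def sum_distrib_left sum_distrib_right by (intro sum.cong refl) simp
      finally show ?thesis
        unfolding hnorm_lincomb_square[OF kx ky] sum.distrib norm_vec_square sum_distrib_left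
        by (simp add: norm_mult power_mult_distrib mult.assoc)
    qed
    finally have *: "?a * (cmod s)\<^sup>2 * (norm (F x))\<^sup>2 + ?b * (cmod t)\<^sup>2 * (norm (F y))\<^sup>2
      + 2 * Re (s * cnj t * (?g * ?k)) \<le> r\<^sup>2 * ?N" .
    have 1: "Re (s * cnj t * (of_real (1 - r\<^sup>2) * ?k)) = (1 - r\<^sup>2) * Re (s * cnj t * ?k)"
    proof -
      have "s * cnj t * (of_real (1 - r\<^sup>2) * ?k) = of_real (1 - r\<^sup>2) * (s * cnj t * ?k)" by (simp only: ac_simps)
      then show ?thesis by (simp only: Re_complex_of_real Im_complex_of_real times_complex.sel)
    qed
    have 2: "Re (s * cnj t * ((1 - ?g) * ?k)) = Re (s * cnj t * ?k) - Re (s * cnj t * (?g * ?k))"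
      by (simp add: left_diff_distrib right_diff_distrib del: times_complex.sel)
    show "(1 - r\<^sup>2) * ?a * (cmod s)\<^sup>2 + (1 - r\<^sup>2) * ?b * (cmod t)\<^sup>2 + 2 * Re (s * cnj t * (of_real (1 - r\<^sup>2) * ?k))
      \<le> (1 - (norm (F x))\<^sup>2) * ?a * (cmod s)\<^sup>2 + (1 - (norm (F y))\<^sup>2) * ?b * (cmod t)\<^sup>2
        + 2 * Re (s * cnj t * ((1 - ?g) * ?k))"
      unfolding 1 2 using * by (simp add: algebra_simps)
  next
    have "(cmod ?k)\<^sup>2 \<le> ?a * ?b"
      using mult_right_mono[OF overlap_le_1[OF B] less_imp_le[OF pos]] overlap_mult[OF B] by simp
    then have "(1 - r\<^sup>2)\<^sup>2 * (cmod ?k)\<^sup>2 \<le> (1 - r\<^sup>2)\<^sup>2 * (?a * ?b)" by (rule mult_left_mono) simp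
    then show "(cmod (of_real (1 - r\<^sup>2) * ?k))\<^sup>2 \<le> (1 - r\<^sup>2) * ?a * ((1 - r\<^sup>2) * ?b)"
      unfolding norm_mult norm_of_real power_mult_distrib power2_abs
      by (simp add: power2_eq_square[of "1 - r\<^sup>2"] ac_simps)
  qed (use r1 in auto)
  \<comment> \<open>\<open>overlap_eq\<close> at the image points and \<open>overlap_mult\<close> at
    \<open>x\<close>, \<open>y\<close> turn the larger determinant into a difference of overlaps.
    The factor \<open>?a * ?b\<close> cancels later.\<close>
  also have "(1 - (norm (F x))\<^sup>2) * ?a * ((1 - (norm (F y))\<^sup>2) * ?b) - (cmod ((1 - ?g) * ?k))\<^sup>2
      = (overlap (F x) (F y) - overlap x y) * (cmod (1 - ?g))\<^sup>2 * (?a * ?b)"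
  proof -
    have "(1 - (norm (F x))\<^sup>2) * ?a * ((1 - (norm (F y))\<^sup>2) * ?b)
        = (1 - (norm (F x))\<^sup>2) * (1 - (norm (F y))\<^sup>2) * (?a * ?b)"
      by (simp only: ac_simps)
    also have "\<dots> = overlap (F x) (F y) * (cmod (1 - ?g))\<^sup>2 * (?a * ?b)"
      by (simp only: overlap_eq[OF FB])
    finally have eq: "(1 - (norm (F x))\<^sup>2) * ?a * ((1 - (norm (F y))\<^sup>2) * ?b)
        = overlap (F x) (F y) * (cmod (1 - ?g))\<^sup>2 * (?a * ?b)" .
    show ?thesis
      unfolding eq norm_mult power_mult_distrib overlap_mult[OF B]
      by (simp only: left_diff_distrib right_diff_distrib ac_simps)
  qed
  also have "(1 - r\<^sup>2) * ?a * ((1 - r\<^sup>2) * ?b) - (cmod (of_real (1 - r\<^sup>2) * ?k))\<^sup>2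
      = (1 - r\<^sup>2)\<^sup>2 * (1 - overlap x y) * (?a * ?b)"
    unfolding norm_mult norm_of_real power_mult_distrib power2_abs overlap_mult[OF B]
    by (simp add: power2_eq_square[of "1 - r\<^sup>2"] algebra_simps)
  finally have 3: "(1 - r\<^sup>2)\<^sup>2 * (1 - overlap x y) \<le> (overlap (F x) (F y) - overlap x y) * (cmod (1 - ?g))\<^sup>2"
    using pos by (simp only: mult_le_cancel_right_pos)
  have "0 \<le> (1 - r\<^sup>2)\<^sup>2 * (1 - overlap x y)" using overlap_le_1[OF B] by simp
  then have nonneg: "0 \<le> (overlap (F x) (F y) - overlap x y) * (cmod (1 - ?g))\<^sup>2" using 3 by linarith
  \<comment> \<open>The bound 2 is the origin of the 4 in the statement. Strict positivity yields
    the sign of the overlap difference, which is needed before 4 may be substituted.\<close>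
  have g: "0 < cmod (1 - ?g)" "cmod (1 - ?g) \<le> 2"
    using cmod_cdot_less[OF FB(2,1)] norm_triangle_ineq4[of 1 ?g] by auto
  have "0 \<le> overlap (F x) (F y) - overlap x y"
    using nonneg g(1) by (simp add: zero_le_mult_iff)
  moreover have "(cmod (1 - ?g))\<^sup>2 \<le> 4"
    using power_mono[OF g(2), of 2] by simp
  ultimately have "(overlap (F x) (F y) - overlap x y) * (cmod (1 - ?g))\<^sup>2
      \<le> (overlap (F x) (F y) - overlap x y) * 4"
    by (intro mult_left_mono)
  then show ?thesis using 3 by simp
qed

section \<open>Riesz representation, operator norms and units on kernel subspaces\<close>

lemma subspace_Riesz_representation:
  fixes L :: "(complex ^ 'd \<Rightarrow> complex) \<Rightarrow> complex"
  assumes V: "V \<subseteq> unit_ball"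
    and "\<And>f g. f \<in> subspace_on H V \<Longrightarrow> g \<in> subspace_on H V \<Longrightarrow> L (\<lambda>z. f z + g z) = L f + L g"
    and "\<And>c f. f \<in> subspace_on H V \<Longrightarrow> L (\<lambda>z. c * f z) = c * L f"
    and "\<And>f. f \<in> subspace_on H V \<Longrightarrow> cmod (L f) \<le> C * hnorm H f"
  obtains u where "u \<in> subspace_on H V" "\<And>f. f \<in> subspace_on H V \<Longrightarrow> L f = ip H f u"
proof -
  interpret S: hilbert_function_space unit_ball "\<lparr>funs = subspace_on H V, ip = ip H\<rparr>"
    by (rule subspace_hilbert_function_space[OF V])
  have "hnorm \<lparr>funs = subspace_on H V, ip = ip H\<rparr> = hnorm H" by (simp add: hnorm_def fun_eq_iff)
  then show ?thesis
    using S.Riesz_representation[of L C] assms(2-) that by auto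
qed

text \<open>Homogeneity extends the supremum over the unit ball to all of \<open>S\<close>.
  Finiteness is essential because \<open>enn2real\<close> maps infinity to 0.\<close>

lemma op_norm_bound:
  assumes S: "S \<subseteq> funs H" "\<And>c f. f \<in> S \<Longrightarrow> (\<lambda>z. c * f z) \<in> S"
    and T: "\<And>f. f \<in> S \<Longrightarrow> T f \<in> funs H" "\<And>c f. f \<in> S \<Longrightarrow> T (\<lambda>z. c * f z) = (\<lambda>z. c * T f z)"
    and finite: "op_norm H S T < \<infinity>" and f: "f \<in> S"
  shows "hnorm H (T f) \<le> enn2real (op_norm H S T) * hnorm H f"
proof (cases "hnorm H f = 0")
  case True
  then have "f = (\<lambda>z. 0 * f z)" using hnorm_eq_zero S f by fastforce
  then have "T f = (\<lambda>z. 0 * T f z)" using T(2)[OF f, of 0] by metis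
  then have "hnorm H (T f) = 0" using hnorm_zero by simp
  then show ?thesis using True by simp
next
  case False
  then have n: "0 < hnorm H f" using hnorm_nonneg[of f] f S by force
  let ?c = "complex_of_real (1 / hnorm H f)"
  have "hnorm H (\<lambda>z. ?c * f z) = 1"
    using n f S by (subst hnorm_scale) (auto simp: norm_divide)
  then have "ennreal (hnorm H (T (\<lambda>z. ?c * f z))) \<le> op_norm H S T"
    unfolding op_norm_def using S(2)[OF f, of ?c] by (intro SUP_upper) simp
  then have "hnorm H (T (\<lambda>z. ?c * f z)) \<le> enn2real (op_norm H S T)"
    using finite by (subst ennreal_le_iff[symmetric]) auto
  also have "hnorm H (T (\<lambda>z. ?c * f z)) = hnorm H (T f) / hnorm H f"
    using n by (simp only: T(2)[OF f] hnorm_scale[OF T(1)[OF f]]) (simp add: norm_divide)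
  finally show ?thesis using n by (simp add: pos_divide_le_eq)
qed

text \<open>The unit of \<open>mult_alg H V\<close>: multipliers must vanish off \<open>V\<close>,
  so the constant 1 is cut off there.\<close>

definition one_on :: "(complex ^ 'd) set \<Rightarrow> complex ^ 'd \<Rightarrow> complex" where
  "one_on V = (\<lambda>x. if x \<in> V then 1 else 0)"

lemma one_on_mem: "one_on V \<in> mult_alg H V"
  by (force simp: mult_alg_def one_on_def)

lemma mult_op_one_on:
  assumes V: "V \<subseteq> unit_ball" and h: "h \<in> subspace_on H V"
  shows "mult_op H V (one_on V) h = h"
  using mult_op_mem[OF V one_on_mem h] h mult_op_apply[OF V one_on_mem h]
  by (intro subspace_eqI[OF V]) (auto simp: one_on_def)

text \<open>A point of \<open>V\<close> provides a unit vector; over the empty set the supremum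
  would be 0. Size 1 suffices for bounding \<open>cb_norm\<close> from below, since that is a
  supremum over all sizes.\<close>

lemma mult_matrix_norm_one_on:
  assumes V: "V \<subseteq> unit_ball" "V \<noteq> {}"
  shows "mult_matrix_norm H V 1 (\<lambda>i j. one_on V) = 1"
proof (rule antisym)
  show "mult_matrix_norm H V 1 (\<lambda>i j. one_on V) \<le> 1"
    unfolding mult_matrix_norm_def
    by (rule SUP_least) (auto simp: mult_op_one_on[OF V(1)] intro!: ennreal_leI[of _ 1, simplified])
  obtain x where x: "x \<in> V" using V by blast
  then have xB: "x \<in> unit_ball" using V by blast
  define h where "h = (\<lambda>j::nat. \<lambda>z. of_real (1 / hnorm H (kf x)) * kf x z)"
  have h: "h j \<in> subspace_on H V" for j
    unfolding h_def by (rule scale_mem_subspace[OF V(1) kf_mem_subspace[OF V(1) x]])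
  have n: "hnorm H (h j) = 1" for j
    unfolding h_def hnorm_scale[OF kf_mem[OF xB]] using hnorm_kf_pos[OF xB] by (simp add: norm_divide)
  have "ennreal (sqrt (\<Sum>i<(1::nat). (hnorm H (\<lambda>z. \<Sum>j<1. mult_op H V (one_on V) (h j) z))\<^sup>2))
      \<le> mult_matrix_norm H V 1 (\<lambda>i j. one_on V)"
    unfolding mult_matrix_norm_def by (rule SUP_upper2[of h]) (use h n in auto)
  then show "1 \<le> mult_matrix_norm H V 1 (\<lambda>i j. one_on V)"
    by (simp add: mult_op_one_on[OF V(1) h] n)
qed

lemma cb_norm_ge_1:
  assumes "V \<subseteq> unit_ball" "V \<noteq> {}" "W \<subseteq> unit_ball" "W \<noteq> {}"
    and "\<phi> (one_on V) = one_on W"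
  shows "1 \<le> cb_norm H V W \<phi>"
proof -
  have "mult_matrix_norm H W 1 (\<lambda>i j. \<phi> (one_on V)) \<le> cb_norm H V W \<phi>"
    unfolding cb_norm_def
    by (rule SUP_upper2[of 1], simp, rule SUP_upper)
      (use one_on_mem mult_matrix_norm_one_on[OF assms(1,2)] in auto)
  then show ?thesis using mult_matrix_norm_one_on[OF assms(3,4)] assms(5) by simp
qed

end

section \<open>Isomorphisms of kernel subspaces\<close>

text \<open>\<open>M\<close> and \<open>N\<close> are arbitrary bounds for \<open>T\<close> and its
  inverse, the latter written as a lower bound for \<open>T\<close>. In this form the locale is
  closed under inversion, with \<open>V\<close>, \<open>W\<close> and \<open>M\<close>,
  \<open>N\<close> exchanged (\<open>inverse\<close>), so each estimate is proved in one direction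
  only.\<close>

locale kernel_isomorphism = drury_arveson_space H
  for H :: "(complex ^ 'd) function_space" +
  fixes V W :: "(complex ^ 'd) set"
    and T :: "(complex ^ 'd \<Rightarrow> complex) \<Rightarrow> (complex ^ 'd \<Rightarrow> complex)"
    and F :: "complex ^ 'd \<Rightarrow> complex ^ 'd"
    and \<delta> :: "complex ^ 'd \<Rightarrow> complex"
    and M N :: real
  assumes V: "V \<subseteq> unit_ball" and W: "W \<subseteq> unit_ball" and nonempty: "V \<noteq> {}"
    and bij_T: "bij_betw T (subspace_on H V) (subspace_on H W)"
    and T_add: "\<lbrakk>f \<in> subspace_on H V; g \<in> subspace_on H V\<rbrakk> \<Longrightarrow> T (\<lambda>z. f z + g z) = (\<lambda>z. T f z + T g z)"
    and T_scale: "f \<in> subspace_on H V \<Longrightarrow> T (\<lambda>z. c * f z) = (\<lambda>z. c * T f z)"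
    and bij_F: "bij_betw F V W"
    and T_kf: "x \<in> V \<Longrightarrow> T (kf x) = (\<lambda>z. \<delta> x * kf (F x) z)"
    and \<delta>: "x \<in> V \<Longrightarrow> \<delta> x \<noteq> 0"
    and T_bound: "f \<in> subspace_on H V \<Longrightarrow> hnorm H (T f) \<le> M * hnorm H f"
    and T_inverse_bound: "f \<in> subspace_on H V \<Longrightarrow> hnorm H f \<le> N * hnorm H (T f)"
    and M_nonneg: "0 \<le> M" and N_nonneg: "0 \<le> N"
begin

lemma F_mem: "x \<in> V \<Longrightarrow> F x \<in> W"
  using bij_F by (auto simp: bij_betw_def)

lemma mem_ball_V: "x \<in> V \<Longrightarrow> x \<in> unit_ball" and F_mem_ball: "x \<in> V \<Longrightarrow> F x \<in> unit_ball"
  using V W F_mem by blast+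

lemma T_mem: "f \<in> subspace_on H V \<Longrightarrow> T f \<in> subspace_on H W"
  using bij_T by (auto simp: bij_betw_def)

lemma one_le: "1 \<le> M * N"
proof -
  obtain x where x: "x \<in> V" using nonempty by blast
  then have k: "kf x \<in> subspace_on H V" by (rule kf_mem_subspace[OF V])
  have "hnorm H (kf x) \<le> N * (M * hnorm H (kf x))"
    using T_inverse_bound[OF k] mult_left_mono[OF T_bound[OF k] N_nonneg] by linarith
  then show ?thesis using hnorm_kf_pos[of x] x V by (auto simp: mult.commute mult.assoc[symmetric])
qed

lemma M_pos: "0 < M" and N_pos: "0 < N"
  using one_le M_nonneg N_nonneg by (auto simp: less_le)

lemma inverse:
  "kernel_isomorphism H W V (inv_into (subspace_on H V) T) (inv_into V F)
    (\<lambda>y. 1 / \<delta> (inv_into V F y)) N M"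
proof -
  let ?T' = "inv_into (subspace_on H V) T" and ?G = "inv_into V F"
  have T'_mem: "?T' g \<in> subspace_on H V" and TT': "T (?T' g) = g" if "g \<in> subspace_on H W" for g
    using bij_T that by (auto simp: bij_betw_def inv_into_into f_inv_into_f)
  have T'I: "?T' g = f" if "f \<in> subspace_on H V" "T f = g" for f g
    using bij_T that by (auto simp: bij_betw_def intro: inv_into_f_eq)
  have G: "?G y \<in> V" and FG: "F (?G y) = y" if "y \<in> W" for y
    using bij_F that by (auto simp: bij_betw_def inv_into_into f_inv_into_f)
  show ?thesis
  proof unfold_locales
    show "V \<subseteq> unit_ball" "W \<subseteq> unit_ball" "0 \<le> M" "0 \<le> N" by (fact V W M_nonneg N_nonneg)+
    show "W \<noteq> {}" using nonempty F_mem by blast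
    show "bij_betw ?T' (subspace_on H W) (subspace_on H V)" by (rule bij_betw_inv_into[OF bij_T])
    show "bij_betw ?G W V" by (rule bij_betw_inv_into[OF bij_F])
  next
    fix f g assume "f \<in> subspace_on H W" "g \<in> subspace_on H W"
    then show "?T' (\<lambda>z. f z + g z) = (\<lambda>z. ?T' f z + ?T' g z)"
      by (intro T'I add_mem_subspace[OF V] T'_mem) (simp_all add: T_add T'_mem TT')
  next
    fix f c assume "f \<in> subspace_on H W"
    then show "?T' (\<lambda>z. c * f z) = (\<lambda>z. c * ?T' f z)"
      by (intro T'I scale_mem_subspace[OF V] T'_mem) (simp_all add: T_scale T'_mem TT')
  next
    fix y assume y: "y \<in> W"
    have k: "kf (?G y) \<in> subspace_on H V" by (rule kf_mem_subspace[OF V G[OF y]])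
    show "?T' (kf y) = (\<lambda>z. 1 / \<delta> (?G y) * kf (?G y) z)"
    proof (rule T'I)
      show "(\<lambda>z. 1 / \<delta> (?G y) * kf (?G y) z) \<in> subspace_on H V" by (rule scale_mem_subspace[OF V k])
      show "T (\<lambda>z. 1 / \<delta> (?G y) * kf (?G y) z) = kf y"
        unfolding T_scale[OF k] T_kf[OF G[OF y]] using \<delta>[OF G[OF y]] FG[OF y] by simp
    qed
    show "1 / \<delta> (?G y) \<noteq> 0" using \<delta>[OF G[OF y]] by simp
  next
    fix f assume f: "f \<in> subspace_on H W"
    show "hnorm H (?T' f) \<le> N * hnorm H f" using T_inverse_bound[OF T'_mem[OF f]] TT'[OF f] by simp
    show "hnorm H f \<le> M * hnorm H (?T' f)" using T_bound[OF T'_mem[OF f]] TT'[OF f] by simp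
  qed
qed

section \<open>Adjoints and the transport of multipliers\<close>

lemma adjoint:
  assumes h: "h \<in> subspace_on H W"
  obtains u where "u \<in> subspace_on H V" "\<And>x. x \<in> V \<Longrightarrow> u x = cnj (\<delta> x) * h (F x)"
    "hnorm H u \<le> M * hnorm H h"
proof -
  have h': "h \<in> funs H" by (rule subspace_on_funs[OF h])
  have T': "T f \<in> funs H" if "f \<in> subspace_on H V" for f by (rule subspace_on_funs[OF T_mem[OF that]])
  have "cmod (ip H (T f) h) \<le> (M * hnorm H h) * hnorm H f" if f: "f \<in> subspace_on H V" for f
    using Cauchy_Schwarz[OF T'[OF f] h'] mult_right_mono[OF T_bound[OF f] hnorm_nonneg[OF h']]
    by (simp add: ac_simps)
  then obtain u where u: "u \<in> subspace_on H V"
      and Lu: "\<And>f. f \<in> subspace_on H V \<Longrightarrow> ip H (T f) h = ip H f u"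
    using subspace_Riesz_representation[OF V, of "\<lambda>f. ip H (T f) h" "M * hnorm H h"]
    by (auto simp: T_add T_scale T' h' ip_add ip_scale)
  have u': "u \<in> funs H" by (rule subspace_on_funs[OF u])
  show ?thesis
  proof (rule that[OF u])
    fix x assume x: "x \<in> V"
    have xB: "x \<in> unit_ball" "F x \<in> unit_ball"
      by (intro mem_ball_V F_mem_ball x)+
    have "u x = cnj (ip H (kf x) u)"
      using ip_kf[OF u' xB(1)] ip_commute[OF kf_mem[OF xB(1)] u'] by simp
    also have "\<dots> = cnj (\<delta> x * ip H (kf (F x)) h)"
      using Lu[OF kf_mem_subspace[OF V x]] T_kf[OF x] xB h' by (simp add: ip_scale kf_mem)
    also have "\<dots> = cnj (\<delta> x) * h (F x)"
      using ip_kf[OF h' xB(2)] ip_commute[OF kf_mem[OF xB(2)] h'] by simp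
    finally show "u x = cnj (\<delta> x) * h (F x)" .
  next
    \<comment> \<open>Testing the representation at \<open>u\<close> itself bounds its norm.\<close>
    have "complex_of_real ((hnorm H u)\<^sup>2) = ip H (T u) h"
      by (simp only: Lu[OF u] ip_self[OF u'])
    then have "(hnorm H u)\<^sup>2 = cmod (ip H (T u) h)"
      by (metis abs_power2 norm_of_real)
    also have "\<dots> \<le> hnorm H (T u) * hnorm H h" by (rule Cauchy_Schwarz[OF T'[OF u] h'])
    also have "\<dots> \<le> (M * hnorm H u) * hnorm H h"
      by (rule mult_right_mono[OF T_bound[OF u] hnorm_nonneg[OF h']])
    finally have "hnorm H u * hnorm H u \<le> hnorm H u * (M * hnorm H h)"
      by (simp add: power2_eq_square ac_simps)
    then show "hnorm H u \<le> M * hnorm H h"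
      using hnorm_nonneg[OF u'] hnorm_nonneg[OF h'] M_nonneg
      by (cases "hnorm H u = 0") (auto simp: mult_le_cancel_left)
  qed
qed

text \<open>The adjoint of the inverse, with values read at \<open>F x\<close>, where they undo the
  factor \<open>cnj (\<delta> x)\<close> produced by \<open>adjoint\<close>.\<close>

lemma inverse_adjoint:
  assumes g: "g \<in> subspace_on H V"
  obtains v where "v \<in> subspace_on H W" "\<And>x. x \<in> V \<Longrightarrow> v (F x) = g x / cnj (\<delta> x)"
    "hnorm H v \<le> N * hnorm H g"
proof (rule kernel_isomorphism.adjoint[OF inverse g])
  fix v
  assume v: "v \<in> subspace_on H W" "hnorm H v \<le> N * hnorm H g"
    and eq: "\<And>y. y \<in> W \<Longrightarrow> v y = cnj (1 / \<delta> (inv_into V F y)) * g (inv_into V F y)"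
  have "v (F x) = g x / cnj (\<delta> x)" if "x \<in> V" for x
    using eq[OF F_mem[OF that]] bij_F that by (simp add: bij_betw_def)
  then show ?thesis using that v by blast
qed

lemma compose_on_F: "x \<in> V \<Longrightarrow> compose_on W f (inv_into V F) (F x) = f x"
  using bij_F F_mem by (simp add: compose_on_def bij_betw_def)

lemma F_surj: "y \<in> W \<Longrightarrow> \<exists>x\<in>V. y = F x"
  using bij_F by (auto simp: bij_betw_def)

text \<open>The witness: pull \<open>h\<close> back by the adjoint, multiply by \<open>f\<close>,
  return by the inverse adjoint. The factors \<open>cnj (\<delta> x)\<close> cancel
  pointwise.\<close>

lemma compose_on_mem_mult_alg:
  assumes f: "f \<in> mult_alg H V"
  shows "compose_on W f (inv_into V F) \<in> mult_alg H W"
  unfolding mult_alg_def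
proof (intro CollectI conjI allI impI ballI)
  fix h assume "h \<in> subspace_on H W"
  then obtain u where u: "u \<in> subspace_on H V" "\<And>x. x \<in> V \<Longrightarrow> u x = cnj (\<delta> x) * h (F x)"
    using adjoint by blast
  obtain v where v: "v \<in> subspace_on H W"
      "\<And>x. x \<in> V \<Longrightarrow> v (F x) = mult_op H V f u x / cnj (\<delta> x)"
    using inverse_adjoint[OF mult_op_mem[OF V f u(1)]] by blast
  have "v y = compose_on W f (inv_into V F) y * h y" if y: "y \<in> W" for y
  proof -
    obtain x where x: "x \<in> V" "y = F x" using F_surj[OF y] by blast
    then show ?thesis
      using \<delta>[OF x(1)] by (simp add: v(2) mult_op_apply[OF V f u(1)] u(2) compose_on_F)
  qed
  with v show "\<exists>g\<in>subspace_on H W. \<forall>y\<in>W. g y = compose_on W f (inv_into V F) y * h y" by blast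
qed (simp add: compose_on_def)

text \<open>With \<open>S = T\<^sup>*\<close>, the matrix \<open>B\<close> acts as \<open>S\<inverse> A S\<close>.\<close>

lemma mult_matrix_norm_compose:
  assumes A: "\<And>i j. i < n \<Longrightarrow> j < n \<Longrightarrow> A i j \<in> mult_alg H V"
    and A1: "mult_matrix_norm H V n A \<le> 1"
    and B: "\<And>i j. i < n \<Longrightarrow> j < n \<Longrightarrow> B i j = compose_on W (A i j) (inv_into V F)"
  shows "mult_matrix_norm H W n B \<le> ennreal (M * N)"
  unfolding mult_matrix_norm_def
proof (rule SUP_least, elim CollectE conjE)
  fix h :: "nat \<Rightarrow> complex ^ 'd \<Rightarrow> complex"
  assume h: "\<forall>j<n. h j \<in> subspace_on H W" and h1: "sqrt (\<Sum>j<n. (hnorm H (h j))\<^sup>2) \<le> 1"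
  \<comment> \<open>For \<open>j \<ge> n\<close> nothing is known about \<open>h j\<close>; with the
    guard under the quantifier, choice yields a single sequence \<open>u\<close>.\<close>
  have "\<exists>u. j < n \<longrightarrow> u \<in> subspace_on H V \<and> (\<forall>x\<in>V. u x = cnj (\<delta> x) * h j (F x))
      \<and> hnorm H u \<le> M * hnorm H (h j)" for j
    using h adjoint[of "h j"] by metis
  then obtain u where u: "j < n \<Longrightarrow> u j \<in> subspace_on H V"
      and u_apply: "j < n \<Longrightarrow> x \<in> V \<Longrightarrow> u j x = cnj (\<delta> x) * h j (F x)"
      and u_norm: "j < n \<Longrightarrow> hnorm H (u j) \<le> M * hnorm H (h j)" for j x
    by metis
  \<comment> \<open>Division by \<open>M\<close> returns the pulled-back tuple to the unit ball,
    where \<open>A1\<close> applies; the factor reappears in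
    \<open>?f i = (\<lambda>z. of_real M * v z)\<close>.\<close>
  define h' where "h' j = (\<lambda>z. of_real (1 / M) * u j z)" for j
  have h': "h' j \<in> subspace_on H V" if "j < n" for j
    unfolding h'_def by (rule scale_mem_subspace[OF V u[OF that]])
  have h'_norm: "hnorm H (h' j) \<le> hnorm H (h j)" if "j < n" for j
    unfolding h'_def hnorm_scale[OF subspace_on_funs[OF u[OF that]]]
    using u_norm[OF that] M_pos by (simp add: norm_divide pos_divide_le_eq mult.commute)
  have "(\<Sum>j<n. (hnorm H (h' j))\<^sup>2) \<le> (\<Sum>j<n. (hnorm H (h j))\<^sup>2)"
    using h'_norm hnorm_nonneg[OF subspace_on_funs[OF h']] by (intro sum_mono power_mono) auto
  then have h'1: "sqrt (\<Sum>j<n. (hnorm H (h' j))\<^sup>2) \<le> 1" using h1 by simp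
  let ?g = "\<lambda>i z. \<Sum>j<n. mult_op H V (A i j) (h' j) z"
  have g: "?g i \<in> subspace_on H V" if "i < n" for i
    using that by (intro sum_mem_subspace[OF V] mult_op_mem[OF V A h']) auto
  have "ennreal (sqrt (\<Sum>i<n. (hnorm H (?g i))\<^sup>2)) \<le> mult_matrix_norm H V n A"
    unfolding mult_matrix_norm_def using h' h'1 by (intro SUP_upper) auto
  with A1 have "ennreal (sqrt (\<Sum>i<n. (hnorm H (?g i))\<^sup>2)) \<le> 1"
    by (rule order_trans[rotated])
  then have g1: "sqrt (\<Sum>i<n. (hnorm H (?g i))\<^sup>2) \<le> 1" by (simp only: ennreal_le_1)
  let ?f = "\<lambda>i z. \<Sum>j<n. mult_op H W (B i j) (h j) z"
  have f_norm: "(hnorm H (?f i))\<^sup>2 \<le> (M * N)\<^sup>2 * (hnorm H (?g i))\<^sup>2" if i: "i < n" for i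
  proof -
    obtain v where v: "v \<in> subspace_on H W" "\<And>x. x \<in> V \<Longrightarrow> v (F x) = ?g i x / cnj (\<delta> x)"
        "hnorm H v \<le> N * hnorm H (?g i)"
      by (rule inverse_adjoint[OF g[OF i]]) (rule that)
    have Bm: "B i j \<in> mult_alg H W" if "j < n" for j
      using compose_on_mem_mult_alg[OF A[OF i that]] B[OF i that] by simp
    have "?f i = (\<lambda>z. of_real M * v z)"
    proof (rule subspace_eqI[OF W])
      show "?f i \<in> subspace_on H W"
        using h by (intro sum_mem_subspace[OF W] mult_op_mem[OF W Bm]) auto
      show "(\<lambda>z. of_real M * v z) \<in> subspace_on H W" by (rule scale_mem_subspace[OF W v(1)])
      fix y assume y: "y \<in> W"
      then obtain x where x: "x \<in> V" "y = F x" using F_surj by blast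
      have "?f i y = (\<Sum>j<n. A i j x * h j y)"
      proof (intro sum.cong refl)
        fix j assume j: "j \<in> {..<n}"
        then have "mult_op H W (B i j) (h j) y = B i j y * h j y"
          using h y by (intro mult_op_apply[OF W Bm]) auto
        then show "mult_op H W (B i j) (h j) y = A i j x * h j y"
          using j x by (simp add: B[OF i] compose_on_F)
      qed
      also have "\<dots> = (\<Sum>j<n. of_real M * (A i j x * h' j x / cnj (\<delta> x)))"
        using \<delta>[OF x(1)] M_pos x by (intro sum.cong refl) (simp add: h'_def u_apply)
      also have "\<dots> = of_real M * (?g i x / cnj (\<delta> x))"
        unfolding sum_divide_distrib sum_distrib_left
        using x by (intro sum.cong refl) (simp add: mult_op_apply[OF V A[OF i] h'])
      finally show "?f i y = of_real M * v y" using v(2) x by simp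
    qed
    then have "hnorm H (?f i) = M * hnorm H v"
      using hnorm_scale[OF subspace_on_funs[OF v(1)], of "of_real M"] M_pos by simp
    also have "\<dots> \<le> M * N * hnorm H (?g i)"
      using mult_left_mono[OF v(3) M_nonneg] by (simp add: mult.assoc)
    finally have "hnorm H (?f i) \<le> M * N * hnorm H (?g i)" .
    moreover have "0 \<le> hnorm H (?f i)"
      using h by (intro hnorm_nonneg subspace_on_funs[of _ W] sum_mem_subspace[OF W] mult_op_mem[OF W Bm]) auto
    ultimately show ?thesis by (subst power_mult_distrib[symmetric]) (rule power_mono)
  qed
  have "sqrt (\<Sum>i<n. (hnorm H (?f i))\<^sup>2) \<le> sqrt ((M * N)\<^sup>2 * (\<Sum>i<n. (hnorm H (?g i))\<^sup>2))"
    unfolding sum_distrib_left using f_norm by (intro real_sqrt_le_mono sum_mono) auto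
  also have "\<dots> = M * N * sqrt (\<Sum>i<n. (hnorm H (?g i))\<^sup>2)"
    using one_le by (simp add: real_sqrt_mult)
  also have "\<dots> \<le> M * N" using g1 one_le by (simp add: mult_left_le)
  finally show "ennreal (sqrt (\<Sum>i<n. (hnorm H (?f i))\<^sup>2)) \<le> ennreal (M * N)" by (rule ennreal_leI)
qed

lemma cb_norm_le:
  assumes "\<And>f. f \<in> mult_alg H V \<Longrightarrow> \<phi> f = compose_on W f (inv_into V F)"
  shows "cb_norm H V W \<phi> \<le> ennreal (M * N)"
  unfolding cb_norm_def
  by (intro SUP_least, rule mult_matrix_norm_compose) (auto simp: assms)

section \<open>Row norms and overlaps under an isomorphism\<close>

lemma T_kcomb:
  assumes "finite A" "A \<subseteq> V"
  shows "T (\<lambda>z. \<Sum>x\<in>A. c x * kf x z) = (\<lambda>z. \<Sum>x\<in>A. (c x * \<delta> x) * kf (F x) z)"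
  using assms
proof (induction A rule: finite_induct)
  case empty
  show ?case using T_scale[OF zero_mem_subspace, of 0] by simp
next
  case (insert x A)
  have k: "kf x \<in> subspace_on H V" using insert by (intro kf_mem_subspace[OF V]) auto
  have "T (\<lambda>z. c x * kf x z + (\<Sum>x\<in>A. c x * kf x z))
      = (\<lambda>z. c x * T (kf x) z + T (\<lambda>z. \<Sum>x\<in>A. c x * kf x z) z)"
    using insert by (subst T_add) (auto intro!: scale_mem_subspace[OF V] kcomb_mem[OF V] simp: T_scale k)
  then show ?case using insert T_kf by (simp add: mult.assoc)
qed

lemma vector_mult_norm_le:
  assumes F: "vector_multiplier H V F"
  shows "vector_mult_norm H V F \<le> ennreal (M * N)"
proof (rule vector_mult_norm_leI[OF V F])
  fix A and c :: "complex ^ 'd \<Rightarrow> complex" assume A: "finite A" "A \<subseteq> V"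
  have FA: "F ` A \<subseteq> unit_ball" using A F_mem_ball by auto
  let ?w = "\<lambda>i z. \<Sum>x\<in>A. (c x * cnj (F x $ i)) * kf x z"
  let ?w' = "\<lambda>i z. \<Sum>x\<in>A. ((c x * \<delta> x) * cnj (F x $ i)) * kf (F x) z"
  have w: "?w i \<in> subspace_on H V" and v: "(\<lambda>z. \<Sum>x\<in>A. c x * kf x z) \<in> subspace_on H V" for i
    by (rule kcomb_mem[OF V A])+
  \<comment> \<open>\<open>T\<close> moves kernel functions along \<open>F\<close> and only rescales
    them, so it sends the column entry \<open>?w i\<close> of \<open>F\<close> to the entry
    \<open>?w' i\<close> of the coordinate column at the points \<open>F x\<close>.\<close>
  have "(\<Sum>i\<in>UNIV. (hnorm H (?w i))\<^sup>2) \<le> (\<Sum>i\<in>UNIV. N\<^sup>2 * (hnorm H (?w' i))\<^sup>2)"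
  proof (rule sum_mono)
    fix i
    have "hnorm H (?w i) \<le> N * hnorm H (?w' i)"
      using T_inverse_bound[OF w[of i]] unfolding T_kcomb[OF A] by (simp add: mult.commute mult.left_commute)
    then show "(hnorm H (?w i))\<^sup>2 \<le> N\<^sup>2 * (hnorm H (?w' i))\<^sup>2"
      using hnorm_nonneg[OF subspace_on_funs[OF w]]
      by (subst power_mult_distrib[symmetric]) (rule power_mono)
  qed
  also have "\<dots> \<le> N\<^sup>2 * (hnorm H (\<lambda>z. \<Sum>x\<in>A. (c x * \<delta> x) * kf (F x) z))\<^sup>2"
    unfolding sum_distrib_left[symmetric] by (intro mult_left_mono coordinate_row_contraction[OF FA]) simp
  also have "\<dots> \<le> N\<^sup>2 * (M * hnorm H (\<lambda>z. \<Sum>x\<in>A. c x * kf x z))\<^sup>2"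
    using T_bound[OF v] hnorm_nonneg[OF subspace_on_funs[OF T_mem[OF v]]] unfolding T_kcomb[OF A]
    by (intro mult_left_mono power_mono) auto
  finally show "(\<Sum>i\<in>UNIV. (hnorm H (?w i))\<^sup>2) \<le> (M * N * hnorm H (\<lambda>z. \<Sum>x\<in>A. c x * kf x z))\<^sup>2"
    by (simp add: power_mult_distrib ac_simps)
qed (use one_le in simp)

text \<open>\<open>1 - overlap x y\<close> is the squared distance of \<open>kf x\<close> from the
  line through \<open>kf y\<close>, relative to the squared norm of \<open>kf x\<close>.
  \<open>T\<close> stretches the distance by at most \<open>M\<close> and shrinks
  \<open>kf x\<close> by at most the factor \<open>N\<close>.\<close>

lemma overlap_distortion:
  assumes x: "x \<in> V" and y: "y \<in> V"
  shows "1 - overlap (F x) (F y) \<le> (M * N)\<^sup>2 * (1 - overlap x y)"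
proof -
  have B: "x \<in> unit_ball" "y \<in> unit_ball" "F x \<in> unit_ball" "F y \<in> unit_ball"
    by (intro mem_ball_V F_mem_ball x y)+
  have k: "kf x \<in> subspace_on H V" "kf y \<in> subspace_on H V" using x y by (auto intro: kf_mem_subspace[OF V])
  let ?c = "ip H (kf x) (kf y) / of_real ((hnorm H (kf y))\<^sup>2)"
  let ?u = "\<lambda>z. kf x z - ?c * kf y z"
  have u: "?u \<in> subspace_on H V" by (intro diff_mem_subspace[OF V] scale_mem_subspace[OF V] k)
  let ?Tx = "T (kf x)" and ?Ty = "T (kf y)"
  have Tf: "?Tx \<in> funs H" "?Ty \<in> funs H" by (intro subspace_on_funs[OF T_mem] k)+
  have Tu: "T ?u = (\<lambda>z. ?Tx z - ?c * ?Ty z)"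
    using T_add[OF k(1) scale_mem_subspace[OF V k(2), of "- ?c"]] T_scale[OF k(2), of "- ?c"] by simp
  have nT: "hnorm H (T (kf z)) = cmod (\<delta> z) * hnorm H (kf (F z))" if "z \<in> V" for z
  proof -
    have "F z \<in> unit_ball" by (rule F_mem_ball[OF that])
    then show ?thesis by (simp only: T_kf[OF that] hnorm_scale[OF kf_mem])
  qed
  have pos: "0 < (hnorm H ?Tx)\<^sup>2 * (hnorm H ?Ty)\<^sup>2"
    using nT[OF x] nT[OF y] \<delta>[OF x] \<delta>[OF y] hnorm_kf_pos[OF B(3)] hnorm_kf_pos[OF B(4)] by simp
  have "(cmod (ip H ?Tx ?Ty))\<^sup>2 = (cmod (\<delta> x) * cmod (\<delta> y))\<^sup>2 * (cmod (ip H (kf (F x)) (kf (F y))))\<^sup>2"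
    by (simp only: T_kf[OF x] T_kf[OF y] ip_scale ip_scale_right scale_mem kf_mem B norm_mult
        complex_mod_cnj power_mult_distrib ac_simps)
  then have ov: "(cmod (ip H ?Tx ?Ty))\<^sup>2 = overlap (F x) (F y) * ((hnorm H ?Tx)\<^sup>2 * (hnorm H ?Ty)\<^sup>2)"
    unfolding overlap_mult[OF B(3,4)] nT[OF x] nT[OF y] by (simp add: power_mult_distrib ac_simps)
  have "(hnorm H (kf y))\<^sup>2 * (hnorm H ?u)\<^sup>2 = (hnorm H (kf y))\<^sup>2 * ((1 - overlap x y) * (hnorm H (kf x))\<^sup>2)"
    unfolding hnorm_diff_proj[OF kf_mem[OF B(1)] kf_mem[OF B(2)]] overlap_mult[OF B(1,2)]
    by (simp add: algebra_simps)
  then have nu: "(hnorm H ?u)\<^sup>2 = (1 - overlap x y) * (hnorm H (kf x))\<^sup>2"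
    using hnorm_kf_pos[OF B(2)] by simp
  have "(1 - overlap (F x) (F y)) * ((hnorm H ?Tx)\<^sup>2 * (hnorm H ?Ty)\<^sup>2)
      = (hnorm H ?Tx)\<^sup>2 * (hnorm H ?Ty)\<^sup>2 - (cmod (ip H ?Tx ?Ty))\<^sup>2"
    unfolding ov by (simp add: algebra_simps)
  \<comment> \<open>\<open>?u\<close> is orthogonal to \<open>kf y\<close>, but its image need not
    be orthogonal to \<open>?Ty\<close>, so only an inequality survives.\<close>
  also have "\<dots> \<le> (hnorm H (T ?u))\<^sup>2 * (hnorm H ?Ty)\<^sup>2"
    unfolding Tu by (rule gram_det_le[OF Tf])
  also have "\<dots> \<le> (M * hnorm H ?u)\<^sup>2 * (hnorm H ?Ty)\<^sup>2"
    using T_bound[OF u] hnorm_nonneg[OF subspace_on_funs[OF T_mem[OF u]]]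
    by (intro mult_right_mono power_mono) auto
  also have "\<dots> = M\<^sup>2 * ((1 - overlap x y) * (hnorm H (kf x))\<^sup>2) * (hnorm H ?Ty)\<^sup>2"
    by (simp only: power_mult_distrib nu)
  also have "\<dots> \<le> M\<^sup>2 * ((1 - overlap x y) * (N * hnorm H ?Tx)\<^sup>2) * (hnorm H ?Ty)\<^sup>2"
    using T_inverse_bound[OF k(1)] hnorm_kf_pos[OF B(1)] overlap_le_1[OF B(1,2)]
    by (intro mult_right_mono mult_left_mono power_mono) auto
  also have "\<dots> = (M * N)\<^sup>2 * (1 - overlap x y) * ((hnorm H ?Tx)\<^sup>2 * (hnorm H ?Ty)\<^sup>2)"
    by (simp add: power_mult_distrib ac_simps)
  finally show ?thesis using pos by (simp only: mult_le_cancel_right_pos)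
qed

lemma overlap_distortion_inverse:
  assumes x: "x \<in> V" and y: "y \<in> V"
  shows "1 - overlap x y \<le> (M * N)\<^sup>2 * (1 - overlap (F x) (F y))"
  using kernel_isomorphism.overlap_distortion[OF inverse F_mem[OF x] F_mem[OF y]] bij_F x y
  by (simp add: bij_betw_def mult.commute[of N])

text \<open>\<open>overlap_gap\<close> solved for the row norm. When \<open>M * N\<close> is large
  the real bound is negative and \<open>ennreal\<close> cuts it to 0, so no smallness assumption
  appears.\<close>

lemma vector_mult_norm_ge:
  assumes F: "vector_multiplier H V F" and xy: "x \<in> V" "y \<in> V" "x \<noteq> y"
  shows "ennreal (1 - sqrt (4 * ((M * N)\<^sup>2 - 1) / (1 - overlap x y))) \<le> vector_mult_norm H V F"
proof -
  have B: "x \<in> unit_ball" "y \<in> unit_ball" "F x \<in> unit_ball" "F y \<in> unit_ball"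
    by (intro mem_ball_V F_mem_ball xy)+
  have L: "0 \<le> (M * N)\<^sup>2 - 1" using one_le by simp
  have D: "0 < 1 - overlap x y" using overlap_less_1[OF B(1,2) xy(3)] by simp
  \<comment> \<open>The upper estimate gives finiteness, so replacing the norm by a real
    \<open>r\<close> loses nothing.\<close>
  have fin: "vector_mult_norm H V F < \<infinity>"
    using vector_mult_norm_le[OF F] by (simp add: le_less_trans)
  define r where "r = enn2real (vector_mult_norm H V F)"
  have r0: "0 \<le> r" and nr: "vector_mult_norm H V F = ennreal r"
    using fin by (simp_all add: r_def)
  have "1 - sqrt (4 * ((M * N)\<^sup>2 - 1) / (1 - overlap x y)) \<le> r"
  proof (cases "r \<le> 1")
    case True
    have "0 \<le> overlap (F x) (F y)" by (simp add: overlap_def)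
    then have "((M * N)\<^sup>2 - 1) * (1 - overlap (F x) (F y)) \<le> (M * N)\<^sup>2 - 1"
      using L by (intro mult_left_le) auto
    \<comment> \<open>By the inverse distortion, the difference is at most
      \<open>(M * N)\<^sup>2 - 1\<close> times \<open>1 - overlap (F x) (F y)\<close>, a factor of
      at most 1.\<close>
    then have "overlap (F x) (F y) - overlap x y \<le> (M * N)\<^sup>2 - 1"
      using overlap_distortion_inverse[OF xy(1,2)] by (simp add: algebra_simps)
    then have "(1 - r\<^sup>2)\<^sup>2 * (1 - overlap x y) \<le> 4 * ((M * N)\<^sup>2 - 1)"
      using overlap_gap[OF V F r0 True _ xy B(3,4)] nr by simp
    then have "(1 - r\<^sup>2)\<^sup>2 \<le> 4 * ((M * N)\<^sup>2 - 1) / (1 - overlap x y)"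
      using D by (simp add: pos_le_divide_eq)
    then have "1 - r\<^sup>2 \<le> sqrt (4 * ((M * N)\<^sup>2 - 1) / (1 - overlap x y))"
      by (rule real_le_rsqrt)
    \<comment> \<open>Hence \<open>1 - r\<close> is at most \<open>1 - r\<^sup>2\<close>, and the
      square disappears from the bound.\<close>
    moreover have "r\<^sup>2 \<le> r" using r0 True by (simp add: power2_eq_square mult_left_le)
    ultimately show ?thesis by linarith
  next
    case False
    have "0 \<le> sqrt (4 * ((M * N)\<^sup>2 - 1) / (1 - overlap x y))" using L D by simp
    then show ?thesis using False by linarith
  qed
  then show ?thesis unfolding nr by (rule ennreal_leI)
qed

section \<open>Completely bounded norms of the induced map and of its inverse\<close>

lemma compose_on_one_on: "compose_on W (one_on V) (inv_into V F) = one_on W"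
  using bij_F by (auto simp: compose_on_def one_on_def bij_betw_def inv_into_into fun_eq_iff)

text \<open>Puts the inverse of \<open>\<phi>\<close> into the shape needed to apply the same bounds
  to the inverted isomorphism. Its point map is \<open>inv_into V F\<close>, hence the iterated
  \<open>inv_into\<close>, which agrees with \<open>F\<close> on \<open>V\<close>.\<close>

lemma inv_into_compose_on:
  assumes \<phi>: "\<And>f. f \<in> mult_alg H V \<Longrightarrow> \<phi> f = compose_on W f (inv_into V F)"
    and f: "f \<in> mult_alg H W"
  shows "inv_into (mult_alg H V) \<phi> f = compose_on V f (inv_into W (inv_into V F))"
    (is "_ = ?g")
proof (rule inv_into_f_eq)
  show g: "?g \<in> mult_alg H V"
    by (rule kernel_isomorphism.compose_on_mem_mult_alg[OF inverse f])
  show "inj_on \<phi> (mult_alg H V)"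
  proof (rule inj_onI, rule ext)
    fix f1 f2 x assume f12: "f1 \<in> mult_alg H V" "f2 \<in> mult_alg H V" "\<phi> f1 = \<phi> f2"
    show "f1 x = f2 x"
    proof (cases "x \<in> V")
      case True
      then show ?thesis using compose_on_F[OF True, of f1] compose_on_F[OF True, of f2] f12 \<phi> by metis
    qed (use f12 in \<open>auto simp: mult_alg_def\<close>)
  qed
  show "\<phi> ?g = f"
  proof
    fix y
    show "\<phi> ?g y = f y"
    proof (cases "y \<in> W")
      case True
      then obtain x where x: "x \<in> V" "y = F x" using F_surj by blast
      have "\<phi> ?g y = ?g x" using x by (simp only: \<phi>[OF g] compose_on_F)
      also have "\<dots> = f y" using x inv_into_inv_into_eq[OF bij_F] by (simp add: compose_on_def)
      finally show ?thesis .
    next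
      case False
      then show ?thesis using f by (simp add: \<phi>[OF g] compose_on_def[of W] mult_alg_def)
    qed
  qed
qed

lemma cb_norm_bounds:
  assumes "\<And>f. f \<in> mult_alg H V \<Longrightarrow> \<phi> f = compose_on W f (inv_into V F)"
  shows "1 \<le> cb_norm H V W \<phi>" "cb_norm H V W \<phi> \<le> ennreal (M * N)"
proof -
  have "W \<noteq> {}" using nonempty F_mem by blast
  then show "1 \<le> cb_norm H V W \<phi>"
    by (rule cb_norm_ge_1[OF V nonempty W]) (simp add: assms one_on_mem compose_on_one_on)
  show "cb_norm H V W \<phi> \<le> ennreal (M * N)" by (rule cb_norm_le[OF assms])
qed

lemma cb_norm_mult_bounds:
  assumes \<phi>: "\<And>f. f \<in> mult_alg H V \<Longrightarrow> \<phi> f = compose_on W f (inv_into V F)"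
  defines "c \<equiv> cb_norm H V W \<phi> * cb_norm H W V (inv_into (mult_alg H V) \<phi>)"
  shows "1 \<le> c" "c \<le> ennreal ((M * N)\<^sup>2)"
proof -
  note 1 = cb_norm_bounds[OF \<phi>]
  note 2 = kernel_isomorphism.cb_norm_bounds[OF inverse inv_into_compose_on[OF \<phi>]]
  show "1 \<le> c" unfolding c_def using mult_mono[OF 1(1) 2(1)] by simp
  have "c \<le> ennreal (M * N) * ennreal (N * M)"
    unfolding c_def using 1(2) 2(2) by (intro mult_mono) auto
  also have "\<dots> = ennreal ((M * N)\<^sup>2)"
    using M_nonneg N_nonneg by (simp add: ennreal_mult[symmetric] power2_eq_square ac_simps)
  finally show "c \<le> ennreal ((M * N)\<^sup>2)" .
qed

end

text \<open>\<open>rkhs_isomorphism\<close> states a bound for \<open>T\<close> only; the bound for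
  the inverse is extracted from the finite product of the two norms. The given \<open>F\<close> and
  \<open>\<delta>\<close> take the place of the existential ones in that definition.\<close>

lemma (in drury_arveson_space) rkhs_isomorphism_kernel_isomorphism:
  assumes V: "V \<subseteq> unit_ball" "V \<noteq> {}" and W: "W \<subseteq> unit_ball"
    and T: "rkhs_isomorphism H V W T" and F: "bij_betw F V W"
    and T_kf: "\<And>x. x \<in> V \<Longrightarrow> T (kf x) = (\<lambda>z. \<delta> x * kf (F x) z)"
    and \<delta>: "\<And>x. x \<in> V \<Longrightarrow> \<delta> x \<noteq> 0"
    and fin: "op_norm H (subspace_on H V) T
      * op_norm H (subspace_on H W) (inv_into (subspace_on H V) T) < \<infinity>" (is "?a * ?b < \<infinity>")
  shows "kernel_isomorphism H V W T F \<delta> (enn2real ?a) (enn2real ?b)"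
proof -
  let ?T' = "inv_into (subspace_on H V) T"
  have bij: "bij_betw T (subspace_on H V) (subspace_on H W)"
    and add: "\<And>f g. f \<in> subspace_on H V \<Longrightarrow> g \<in> subspace_on H V \<Longrightarrow> T (\<lambda>z. f z + g z) = (\<lambda>z. T f z + T g z)"
    and scale: "\<And>c f. f \<in> subspace_on H V \<Longrightarrow> T (\<lambda>z. c * f z) = (\<lambda>z. c * T f z)"
    and a: "?a < \<infinity>"
    using T unfolding rkhs_isomorphism_def by blast+
  have mem: "T f \<in> subspace_on H W" and T'T: "?T' (T f) = f" if "f \<in> subspace_on H V" for f
    using bij that by (auto simp: bij_betw_def)
  have T'_mem: "?T' g \<in> subspace_on H V" and TT': "T (?T' g) = g" if "g \<in> subspace_on H W" for g
    using bij that by (auto simp: bij_betw_def inv_into_into f_inv_into_f)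
  have T'_scale: "?T' (\<lambda>z. c * g z) = (\<lambda>z. c * ?T' g z)" if g: "g \<in> subspace_on H W" for c g
  proof -
    have "T (\<lambda>z. c * ?T' g z) = (\<lambda>z. c * g z)" by (simp only: scale[OF T'_mem[OF g]] TT'[OF g])
    then show ?thesis using T'T[OF scale_mem_subspace[OF V(1) T'_mem[OF g], of c]] by simp
  qed
  have bound: "hnorm H (T f) \<le> enn2real ?a * hnorm H f" if f: "f \<in> subspace_on H V" for f
    by (rule op_norm_bound[OF subspace_on_subset scale_mem_subspace[OF V(1)]
          subspace_on_funs[OF mem] scale a f])
  obtain x where x: "x \<in> V" using V by blast
  have xB: "x \<in> unit_ball" "F x \<in> unit_ball" using x V W F by (auto simp: bij_betw_def)
  have "0 < hnorm H (T (kf x))"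
    using T_kf[OF x] \<delta>[OF x] hnorm_kf_pos[OF xB(2)] hnorm_scale[OF kf_mem[OF xB(2)], of "\<delta> x"] by simp
  \<comment> \<open>In \<open>ennreal\<close>, \<open>0 * \<infinity> = 0\<close>: a finite product
    bounds the second factor only if the first is nonzero.\<close>
  then have "?a \<noteq> 0" using bound[OF kf_mem_subspace[OF V(1) x]] by auto
  then have b: "?b < \<infinity>" using fin by (auto simp: ennreal_mult_less_top)
  have "hnorm H f \<le> enn2real ?b * hnorm H (T f)" if f: "f \<in> subspace_on H V" for f
    using op_norm_bound[OF subspace_on_subset scale_mem_subspace[OF W]
          subspace_on_funs[OF T'_mem] T'_scale b mem[OF f]] T'T[OF f] by simp
  then show ?thesis
    by unfold_locales (use V W bij add scale F T_kf \<delta> bound in auto)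
qed

text \<open>The inverse multiplier map agrees with \<open>inv_into V F\<close> on \<open>W\<close>,
  and \<open>component\<close> sees only values there.\<close>

lemma multiplier_biholomorphism_bij:
  assumes "multiplier_biholomorphism H V W F"
  shows "bij_betw F V W" "vector_multiplier H V F" "vector_multiplier H W (inv_into V F)"
proof -
  obtain G where G: "vector_multiplier H W G" "\<And>x. x \<in> V \<Longrightarrow> G (F x) = x"
      and F: "vector_multiplier H V F" "F ` V = W"
    using assms unfolding multiplier_biholomorphism_def by blast
  have inj: "inj_on F V" using G(2) by (rule inj_on_inverseI)
  then show "bij_betw F V W" using F by (simp add: bij_betw_def)
  show "vector_multiplier H V F" by (rule F(1))
  have "component W (inv_into V F) i = component W G i" for i
    using F(2) G(2) inj by (auto simp: component_def fun_eq_iff)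
  then show "vector_multiplier H W (inv_into V F)" using G(1) by (simp add: vector_multiplier_def)
qed

lemma tendsto_one_minus_sqrt:
  assumes "(f \<longlongrightarrow> 0) net"
  shows "((\<lambda>n. ennreal (1 - sqrt (f n))) \<longlongrightarrow> 1) net"
  using tendsto_ennrealI[OF tendsto_diff[OF tendsto_const[of 1] tendsto_real_sqrt[OF assms]]] by simp

theorem theorem1p39:
  fixes H :: "(complex ^ 'd) function_space"
    and V :: "(complex ^ 'd) set"
    and W :: "nat \<Rightarrow> (complex ^ 'd) set"
    and T :: "nat \<Rightarrow> (complex ^ 'd \<Rightarrow> complex) \<Rightarrow> (complex ^ 'd \<Rightarrow> complex)"
    and F :: "nat \<Rightarrow> complex ^ 'd \<Rightarrow> complex ^ 'd"
    and \<delta> :: "nat \<Rightarrow> complex ^ 'd \<Rightarrow> complex"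
    and \<phi> :: "nat \<Rightarrow> (complex ^ 'd \<Rightarrow> complex) \<Rightarrow> (complex ^ 'd \<Rightarrow> complex)"
  assumes "drury_arveson H"
    and "variety H V"
    and "\<exists>x\<in>V. \<exists>y\<in>V. x \<noteq> y"
    and "\<And>n. variety H (W n)"
    and "\<And>n. rkhs_isomorphism H V (W n) (T n)"
    and "\<And>n x. x \<in> V \<Longrightarrow> T n (kf x) = (\<lambda>z. \<delta> n x * kf (F n x) z)"
    and "\<And>n. multiplier_biholomorphism H V (W n) (F n)"
    and "\<And>n x. x \<in> V \<Longrightarrow> \<delta> n x \<noteq> 0"
    and "\<And>n f. f \<in> mult_alg H V \<Longrightarrow> \<phi> n f = compose_on (W n) f (inv_into V (F n))"
    and "(\<lambda>n. op_norm H (subspace_on H V) (T n) *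
              op_norm H (subspace_on H (W n)) (inv_into (subspace_on H V) (T n)))
         \<longlonglongrightarrow> 1"
  shows "((\<lambda>n. cb_norm H V (W n) (\<phi> n) * cb_norm H (W n) V (inv_into (mult_alg H V) (\<phi> n)))
            \<longlonglongrightarrow> 1) \<and>
         ((\<lambda>n. vector_mult_norm H V (F n)) \<longlonglongrightarrow> 1) \<and>
         ((\<lambda>n. vector_mult_norm H (W n) (inv_into V (F n))) \<longlonglongrightarrow> 1)"
proof -
  interpret drury_arveson_space H
    using assms(1) by (simp add: drury_arveson_def drury_arveson_space_def)
  obtain x y where xy: "x \<in> V" "y \<in> V" "x \<noteq> y" using assms(3) by blast
  have V: "V \<subseteq> unit_ball" "V \<noteq> {}" using assms(2) xy by (auto simp: variety_def)
  have W: "W n \<subseteq> unit_ball" for n using assms(4)[of n] by (auto simp: variety_def)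
  note bij = multiplier_biholomorphism_bij(1)[OF assms(7)]
    and Fm = multiplier_biholomorphism_bij(2)[OF assms(7)]
    and Gm = multiplier_biholomorphism_bij(3)[OF assms(7)]
  define a where "a n = op_norm H (subspace_on H V) (T n)" for n
  define b where "b n = op_norm H (subspace_on H (W n)) (inv_into (subspace_on H V) (T n))" for n
  define L where "L n = enn2real (a n) * enn2real (b n)" for n
  have lim: "(\<lambda>n. a n * b n) \<longlonglongrightarrow> 1" using assms(10) by (simp only: a_def b_def)
  have L: "L \<longlonglongrightarrow> 1"
    using tendsto_enn2real[of "\<lambda>n. a n * b n" 1] lim by (simp add: L_def[abs_def] enn2real_mult)
  \<comment> \<open>Convergence yields finiteness of the product of norms only from some index on,
    so the estimates below hold eventually.\<close>
  have ev: "\<forall>\<^sub>F n in sequentially. kernel_isomorphism H V (W n) (T n) (F n) (\<delta> n)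
      (enn2real (a n)) (enn2real (b n))"
    using order_tendstoD(2)[OF lim, of \<infinity>, simplified]
    unfolding a_def b_def
    by eventually_elim
      (rule rkhs_isomorphism_kernel_isomorphism[OF V W assms(5) bij assms(6) assms(8)], auto)
  have D: "0 < 1 - overlap x y"
    using overlap_less_1[OF subsetD[OF V(1) xy(1)] subsetD[OF V(1) xy(2)] xy(3)] by simp
  have upper: "(\<lambda>n. ennreal (L n)) \<longlonglongrightarrow> 1" "(\<lambda>n. ennreal ((L n)\<^sup>2)) \<longlonglongrightarrow> 1"
    using tendsto_ennrealI[OF L] tendsto_ennrealI[OF tendsto_power[OF L, of 2]] by simp_all
  have "(\<lambda>n. 4 * ((L n)\<^sup>2 - 1) / (1 - overlap x y)) \<longlonglongrightarrow> 4 * (1\<^sup>2 - 1) / (1 - overlap x y)"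
    by (intro tendsto_intros L) (use D in simp)
  then have lower1: "(\<lambda>n. ennreal (1 - sqrt (4 * ((L n)\<^sup>2 - 1) / (1 - overlap x y)))) \<longlonglongrightarrow> 1"
    by (intro tendsto_one_minus_sqrt) simp
  \<comment> \<open>For the inverse maps the pair \<open>F n x\<close>, \<open>F n y\<close> varies
    with \<open>n\<close>; \<open>(1 - overlap x y) / (L n)\<^sup>2\<close> is the lower bound for
    \<open>1 - overlap (F n x) (F n y)\<close> supplied by the distortion estimate.\<close>
  have "(\<lambda>n. 4 * ((L n)\<^sup>2 - 1) / ((1 - overlap x y) / (L n)\<^sup>2))
      \<longlonglongrightarrow> 4 * (1\<^sup>2 - 1) / ((1 - overlap x y) / 1\<^sup>2)"
    by (intro tendsto_intros L) (use D in simp_all)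
  then have lower2: "(\<lambda>n. ennreal (1 - sqrt (4 * ((L n)\<^sup>2 - 1) / ((1 - overlap x y) / (L n)\<^sup>2)))) \<longlonglongrightarrow> 1"
    by (intro tendsto_one_minus_sqrt) simp
  have "(\<lambda>n. cb_norm H V (W n) (\<phi> n) * cb_norm H (W n) V (inv_into (mult_alg H V) (\<phi> n))) \<longlonglongrightarrow> 1"
  proof (rule tendsto_sandwich[OF _ _ tendsto_const upper(2)])
    show "\<forall>\<^sub>F n in sequentially. 1 \<le> cb_norm H V (W n) (\<phi> n) * cb_norm H (W n) V (inv_into (mult_alg H V) (\<phi> n))"
      using ev by eventually_elim (rule kernel_isomorphism.cb_norm_mult_bounds(1)[OF _ assms(9)])
    show "\<forall>\<^sub>F n in sequentially. cb_norm H V (W n) (\<phi> n) * cb_norm H (W n) V (inv_into (mult_alg H V) (\<phi> n))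
        \<le> ennreal ((L n)\<^sup>2)"
      using ev unfolding L_def by eventually_elim (rule kernel_isomorphism.cb_norm_mult_bounds(2)[OF _ assms(9)])
  qed
  moreover have "(\<lambda>n. vector_mult_norm H V (F n)) \<longlonglongrightarrow> 1"
  proof (rule tendsto_sandwich[OF _ _ lower1 upper(1)])
    show "\<forall>\<^sub>F n in sequentially. ennreal (1 - sqrt (4 * ((L n)\<^sup>2 - 1) / (1 - overlap x y))) \<le> vector_mult_norm H V (F n)"
      using ev unfolding L_def by eventually_elim (rule kernel_isomorphism.vector_mult_norm_ge[OF _ Fm xy])
    show "\<forall>\<^sub>F n in sequentially. vector_mult_norm H V (F n) \<le> ennreal (L n)"
      using ev unfolding L_def by eventually_elim (rule kernel_isomorphism.vector_mult_norm_le[OF _ Fm])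
  qed
  moreover have "(\<lambda>n. vector_mult_norm H (W n) (inv_into V (F n))) \<longlonglongrightarrow> 1"
  proof (rule tendsto_sandwich[OF _ _ lower2 upper(1)])
    show "\<forall>\<^sub>F n in sequentially. ennreal (1 - sqrt (4 * ((L n)\<^sup>2 - 1) / ((1 - overlap x y) / (L n)\<^sup>2)))
        \<le> vector_mult_norm H (W n) (inv_into V (F n))"
      using ev
    proof eventually_elim
      fix n
      assume "kernel_isomorphism H V (W n) (T n) (F n) (\<delta> n) (enn2real (a n)) (enn2real (b n))"
      then interpret K: kernel_isomorphism H V "W n" "T n" "F n" "\<delta> n" "enn2real (a n)" "enn2real (b n)" .
      have L1: "1 \<le> L n" unfolding L_def by (rule K.one_le)
      have ne: "F n x \<noteq> F n y" using xy bij[of n] by (auto simp: bij_betw_def inj_on_def)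
      have le: "(1 - overlap x y) / (L n)\<^sup>2 \<le> 1 - overlap (F n x) (F n y)"
        using K.overlap_distortion_inverse[OF xy(1,2)] L1
        by (simp add: L_def[symmetric] pos_divide_le_eq mult.commute)
      have "4 * ((L n)\<^sup>2 - 1) / (1 - overlap (F n x) (F n y)) \<le> 4 * ((L n)\<^sup>2 - 1) / ((1 - overlap x y) / (L n)\<^sup>2)"
        using L1 D by (intro divide_left_mono le mult_pos_pos less_le_trans[OF _ le]) auto
      then have "ennreal (1 - sqrt (4 * ((L n)\<^sup>2 - 1) / ((1 - overlap x y) / (L n)\<^sup>2)))
          \<le> ennreal (1 - sqrt (4 * ((L n)\<^sup>2 - 1) / (1 - overlap (F n x) (F n y))))"
        by (intro ennreal_leI diff_left_mono real_sqrt_le_mono)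
      also have "\<dots> \<le> vector_mult_norm H (W n) (inv_into V (F n))"
        using kernel_isomorphism.vector_mult_norm_ge[OF K.inverse Gm K.F_mem[OF xy(1)] K.F_mem[OF xy(2)] ne]
        by (simp only: L_def mult.commute)
      finally show "ennreal (1 - sqrt (4 * ((L n)\<^sup>2 - 1) / ((1 - overlap x y) / (L n)\<^sup>2)))
          \<le> vector_mult_norm H (W n) (inv_into V (F n))" .
    qed
    show "\<forall>\<^sub>F n in sequentially. vector_mult_norm H (W n) (inv_into V (F n)) \<le> ennreal (L n)"
      using ev
    proof eventually_elim
      fix n
      assume "kernel_isomorphism H V (W n) (T n) (F n) (\<delta> n) (enn2real (a n)) (enn2real (b n))"
      from kernel_isomorphism.vector_mult_norm_le[OF kernel_isomorphism.inverse[OF this] Gm]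
      show "vector_mult_norm H (W n) (inv_into V (F n)) \<le> ennreal (L n)"
        by (simp only: L_def mult.commute)
    qed
  qed
  ultimately show ?thesis by blast
qed

end
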